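(* If the problem Eval (given a graph database $\mathcal D$ and an RPQ $q$, compute $q(\mathcal D)$) can be solved in time $O((|q(\mathcal D)|+|\mathcal D|)f(|q|))$ for some function $f$, then the SBMM-hypothesis fails.
   Context: $\Sigma$ is a fixed finite alphabet of constant size. A graph database over $\Sigma$ is a pair $\mathcal{D}=(V_{\mathcal D},E_{\mathcal D})$ with a finite node set and arc set $E_{\mathcal D}\subseteq V_{\mathcal D}\times\Sigma\times V_{\mathcal D}$, of size $|\mathcal D|=\max\{|V_{\mathcal D}|,|E_{\mathcal D}|\}$, represented by adjacency lists. A path from $u$ to $v$ is a sequence $u=w_0,a_1,w_1,\dots,a_k,w_k=v$ ($k\ge0$) with $(w_{i-1},a_i,w_i)\in E_{\mathcal D}$, labelled by $a_1\cdots a_k$. An RPQ $q$ is a regular expression over $\Sigma$ (built from $\varepsilon$, letters, concatenation, alternation, Kleene plus), $|q|$ its length; $q(\mathcal D)$ is the set of node pairs $(u,v)$ such that some path from $u$ to $v$ is labelled by a word in the language of $q$. Model: RAM with logarithmic word size. Sparse Boolean matrix multiplication (SBMM): given Boolean $n\times n$ matrices $A,B$, each represented as the set $\{(i,j):A[i,j]=1\}$ of its 1-entries, compute $A\times B$ in the same representation. SBMM-hypothesis: there is no algorithm solving SBMM in time $O(m)$, where $m$ is the total number of 1-entries of $A$, $B$ and $A\times B$. *)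

theory Defs
  imports Main
begin

section \<open>Random access machines with logarithmic word size\<close>

datatype binop = Add | Sub | Mul | Div | Mod | And | Or | Xor | Shl | Shr

text \<open>Subtraction is truncated at 0, and division by 0 yields 0.\<close>

fun eval_binop :: "binop \<Rightarrow> nat \<Rightarrow> nat \<Rightarrow> nat" where
  "eval_binop Add x y = x + y"
| "eval_binop Sub x y = x - y"
| "eval_binop Mul x y = x * y"
| "eval_binop Div x y = x div y"
| "eval_binop Mod x y = x mod y"
| "eval_binop And x y = Bit_Operations.and x y"
| "eval_binop Or x y = Bit_Operations.or x y"
| "eval_binop Xor x y = Bit_Operations.xor x y"
| "eval_binop Shl x y = push_bit y x"
| "eval_binop Shr x y = drop_bit y x"

datatype instr =
    Const nat nat             \<comment> \<open>\<open>Const r k\<close>: register \<open>r\<close> becomes \<open>k\<close>\<close>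
  | Bin binop nat nat nat     \<comment> \<open>\<open>Bin f r s t\<close>: register \<open>r\<close> becomes \<open>f\<close> of registers \<open>s\<close> and \<open>t\<close>\<close>
  | Load nat nat              \<comment> \<open>\<open>Load r s\<close>: register \<open>r\<close> becomes the memory cell addressed by register \<open>s\<close>\<close>
  | Store nat nat             \<comment> \<open>\<open>Store r s\<close>: the memory cell addressed by register \<open>r\<close> becomes register \<open>s\<close>\<close>
  | Jump nat
  | JumpZero nat nat          \<comment> \<open>\<open>JumpZero r l\<close>: jump to position \<open>l\<close> if register \<open>r\<close> is 0\<close>

record config =
  pc :: nat
  reg :: "nat \<Rightarrow> nat"
  mem :: "nat \<Rightarrow> nat"

fun exec :: "instr \<Rightarrow> config \<Rightarrow> config" where
  "exec (Const r k) s = s\<lparr>pc := Suc (pc s), reg := (reg s)(r := k)\<rparr>"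
| "exec (Bin f r x y) s =
     s\<lparr>pc := Suc (pc s), reg := (reg s)(r := eval_binop f (reg s x) (reg s y))\<rparr>"
| "exec (Load r x) s = s\<lparr>pc := Suc (pc s), reg := (reg s)(r := mem s (reg s x))\<rparr>"
| "exec (Store r x) s = s\<lparr>pc := Suc (pc s), mem := (mem s)(reg s r := reg s x)\<rparr>"
| "exec (Jump l) s = s\<lparr>pc := l\<rparr>"
| "exec (JumpZero r l) s = s\<lparr>pc := (if reg s r = 0 then l else Suc (pc s))\<rparr>"

text \<open>A program halts by leaving its code. A program mentions only finitely many registers.\<close>

definition halted :: "instr list \<Rightarrow> config \<Rightarrow> bool" where
  "halted P s \<longleftrightarrow> length P \<le> pc s"

definition step :: "instr list \<Rightarrow> config \<Rightarrow> config" where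
  "step P s = (if halted P s then s else exec (P ! pc s) s)"

definition initial :: "nat list \<Rightarrow> config" where
  "initial xs = \<lparr>pc = 0, reg = (\<lambda>_. 0), mem = (\<lambda>i. if i < length xs then xs ! i else 0)\<rparr>"

text \<open>
  The contents of all registers and memory cells (and hence all addresses) have to be smaller
  than this limit, which means that they fit into \<open>c * log N\<close> bits, where \<open>N\<close> is
  essentially the maximum of the number of input words and the largest input word.
\<close>

definition word_limit :: "nat \<Rightarrow> nat list \<Rightarrow> nat" where
  "word_limit c xs = (length xs + Max (insert 0 (set xs)) + 2) ^ c"

definition fits :: "nat \<Rightarrow> config \<Rightarrow> bool" where
  "fits b s \<longleftrightarrow> (\<forall>r. reg s r < b) \<and> (\<forall>a. mem s a < b)"

text \<open>
  Both problems below ask for a list of pairs. On termination, register 0 points to a memory block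
  that consists of the number of pairs followed by the pairs.
\<close>

definition output_pairs :: "config \<Rightarrow> (nat \<times> nat) list" where
  "output_pairs s =
     (let p = reg s 0
      in map (\<lambda>t. (mem s (p + 1 + 2 * t), mem s (p + 2 + 2 * t))) [0..<mem s p])"

text \<open>
  On input \<open>xs\<close>, \<open>P\<close> halts after at most \<open>T\<close> steps, never exceeds the word size
  with parameter \<open>c\<close>, and its output lists each element of \<open>R\<close> exactly once.
\<close>

definition computes_within :: "instr list \<Rightarrow> nat \<Rightarrow> nat list \<Rightarrow> nat \<Rightarrow> (nat \<times> nat) set \<Rightarrow> bool" where
  "computes_within P c xs T R \<longleftrightarrow>
     (\<exists>t \<le> T.
        halted P ((step P ^^ t) (initial xs)) \<and>
        (\<forall>t' \<le> t. fits (word_limit c xs) ((step P ^^ t') (initial xs))) \<and>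
        distinct (output_pairs ((step P ^^ t) (initial xs))) \<and>
        set (output_pairs ((step P ^^ t) (initial xs))) = R)"

fun flatten_pairs :: "(nat \<times> nat) list \<Rightarrow> nat list" where
  "flatten_pairs [] = []"
| "flatten_pairs ((x, y) # ps) = x # y # flatten_pairs ps"


section \<open>Graph databases and regular path queries\<close>

text \<open>The alphabet is the universe of a finite type \<open>'a\<close>.\<close>

record ('v, 'a) graph_db =
  nodes :: "'v set"
  arcs :: "('v \<times> 'a \<times> 'v) set"

definition graph_database :: "('v, 'a) graph_db \<Rightarrow> bool" where
  "graph_database D \<longleftrightarrow> finite (nodes D) \<and> arcs D \<subseteq> nodes D \<times> UNIV \<times> nodes D"

definition db_size :: "('v, 'a) graph_db \<Rightarrow> nat" where
  "db_size D = max (card (nodes D)) (card (arcs D))"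

text \<open>\<open>ws\<close> is the sequence of nodes and \<open>as\<close> the label of a path from \<open>u\<close> to \<open>v\<close>.\<close>

definition is_path :: "('v, 'a) graph_db \<Rightarrow> 'v \<Rightarrow> 'v list \<Rightarrow> 'a list \<Rightarrow> 'v \<Rightarrow> bool" where
  "is_path D u ws as v \<longleftrightarrow>
     length ws = Suc (length as) \<and> set ws \<subseteq> nodes D \<and>
     ws ! 0 = u \<and> ws ! length as = v \<and>
     (\<forall>i < length as. (ws ! i, as ! i, ws ! Suc i) \<in> arcs D)"

datatype 'a rpq = Eps | Sym 'a | Cat "'a rpq" "'a rpq" | Alt "'a rpq" "'a rpq" | Plus "'a rpq"

fun lang :: "'a rpq \<Rightarrow> 'a list set" where
  "lang Eps = {[]}"
| "lang (Sym a) = {[a]}"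
| "lang (Cat r s) = {x @ y | x y. x \<in> lang r \<and> y \<in> lang s}"
| "lang (Alt r s) = lang r \<union> lang s"
| "lang (Plus r) = {concat xs | xs. xs \<noteq> [] \<and> set xs \<subseteq> lang r}"

definition rpq_result :: "'a rpq \<Rightarrow> ('v, 'a) graph_db \<Rightarrow> ('v \<times> 'v) set" where
  "rpq_result q D =
     {(u, v). u \<in> nodes D \<and> v \<in> nodes D \<and> (\<exists>ws as. is_path D u ws as v \<and> as \<in> lang q)}"

text \<open>
  Queries are written as strings in prefix notation, one memory word per symbol. The function
  \<open>num\<close> assigns numbers to the letters of the alphabet.
\<close>

fun rpq_string :: "('a \<Rightarrow> nat) \<Rightarrow> 'a rpq \<Rightarrow> nat list" where
  "rpq_string num Eps = [0]"
| "rpq_string num (Cat r s) = 1 # rpq_string num r @ rpq_string num s"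
| "rpq_string num (Alt r s) = 2 # rpq_string num r @ rpq_string num s"
| "rpq_string num (Plus r) = 3 # rpq_string num r"
| "rpq_string num (Sym a) = [4 + num a]"

fun rpq_length :: "'a rpq \<Rightarrow> nat" where
  "rpq_length Eps = 1"
| "rpq_length (Sym a) = 1"
| "rpq_length (Cat r s) = 1 + rpq_length r + rpq_length s"
| "rpq_length (Alt r s) = 1 + rpq_length r + rpq_length s"
| "rpq_length (Plus r) = 1 + rpq_length r"

text \<open>
  The node \<open>vs ! i\<close> is represented by its index \<open>i\<close>, and \<open>adj ! i\<close> lists its outgoing
  arcs, in any order, as pairs of a letter and the index of the target node.
\<close>

definition adjacency_lists ::
    "('v, 'a) graph_db \<Rightarrow> 'v list \<Rightarrow> ('a \<times> nat) list list \<Rightarrow> bool" where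
  "adjacency_lists D vs adj \<longleftrightarrow>
     distinct vs \<and> set vs = nodes D \<and> length adj = length vs \<and>
     (\<forall>i < length vs. distinct (adj ! i) \<and>
        set (adj ! i) = {(a, j). j < length vs \<and> (vs ! i, a, vs ! j) \<in> arcs D})"

text \<open>
  Memory layout: the number \<open>n\<close> of nodes, the number \<open>e\<close> of arcs, an array of \<open>n + 1\<close> offsets,
  and the concatenation of the adjacency lists; the list of node \<open>i\<close> ranges from the \<open>i\<close>-th
  (inclusive) to the \<open>(i + 1)\<close>-th (exclusive) offset. Then follow the length of the query and
  the query.
\<close>

definition eval_input :: "('a \<Rightarrow> nat) \<Rightarrow> ('a \<times> nat) list list \<Rightarrow> 'a rpq \<Rightarrow> nat list" where
  "eval_input num adj q =
     [length adj, length (concat adj)] @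
     map (\<lambda>i. length (concat (take i adj))) [0..<Suc (length adj)] @
     flatten_pairs (map (\<lambda>(a, j). (num a, j)) (concat adj)) @
     [length (rpq_string num q)] @ rpq_string num q"

text \<open>
  Eval can be solved in time \<open>O((|q(D)| + |D|) f(|q|))\<close>. The summand 1 accounts for the empty
  database, on which the bound would otherwise be 0.
\<close>

definition eval_solvable :: "('a::finite \<Rightarrow> nat) \<Rightarrow> (nat \<Rightarrow> nat) \<Rightarrow> bool" where
  "eval_solvable num f \<longleftrightarrow>
     (\<exists>P c C. \<forall>(D :: (nat, 'a) graph_db) vs adj q.
        graph_database D \<longrightarrow> adjacency_lists D vs adj \<longrightarrow>
        computes_within P c (eval_input num adj q)
          (C * ((card (rpq_result q D) + db_size D + 1) * f (rpq_length q)))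
          {(i, j). i < length vs \<and> j < length vs \<and> (vs ! i, vs ! j) \<in> rpq_result q D})"


section \<open>Sparse Boolean matrix multiplication\<close>

text \<open>
  A Boolean \<open>n \<times> n\<close> matrix is given by a function that is relevant only for indices below \<open>n\<close>.
\<close>

type_synonym bool_matrix = "nat \<Rightarrow> nat \<Rightarrow> bool"

definition bool_matrix_mult :: "nat \<Rightarrow> bool_matrix \<Rightarrow> bool_matrix \<Rightarrow> bool_matrix" where
  "bool_matrix_mult n A B = (\<lambda>i j. \<exists>k<n. A i k \<and> B k j)"

definition one_entries :: "nat \<Rightarrow> bool_matrix \<Rightarrow> (nat \<times> nat) set" where
  "one_entries n A = {(i, j). i < n \<and> j < n \<and> A i j}"

definition sbmm_input :: "nat \<Rightarrow> (nat \<times> nat) list \<Rightarrow> (nat \<times> nat) list \<Rightarrow> nat list" where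
  "sbmm_input n as bs = [n, length as, length bs] @ flatten_pairs as @ flatten_pairs bs"

text \<open>
  The lists \<open>as\<close> and \<open>bs\<close> contain the 1-entries of \<open>A\<close> and \<open>B\<close> in any order. As above, the
  summand 1 accounts for the case of no 1-entries at all.
\<close>

definition sbmm_linear_time :: bool where
  "sbmm_linear_time \<longleftrightarrow>
     (\<exists>P c C. \<forall>n A B as bs.
        distinct as \<longrightarrow> set as = one_entries n A \<longrightarrow>
        distinct bs \<longrightarrow> set bs = one_entries n B \<longrightarrow>
        computes_within P c (sbmm_input n as bs)
          (C * (card (one_entries n A) + card (one_entries n B) +
                card (one_entries n (bool_matrix_mult n A B)) + 1))
          (one_entries n (bool_matrix_mult n A B)))"

definition sbmm_hypothesis :: bool where
  "sbmm_hypothesis \<longleftrightarrow> \<not> sbmm_linear_time"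

end

(*
  A product A * B is the set of pairs connected by a path of length 2 in the graph with an arc from
  row i to middle index k for every 1-entry (i, k) of A and from k to column j for every 1-entry
  (k, j) of B. So the fixed query a a on this graph, whose size is linear in the number of 1-entries,
  returns exactly the 1-entries of the product. A RAM builds the adjacency lists in linear time:
  since memory is initially 0 and addresses up to a polynomial in n are allowed, indices are renamed
  by direct addressing, and counting sort groups the arcs by source. The program for Eval is then run
  with its registers and memory shifted, and the node numbers in its output are translated back.
*)

theory Submission
  imports Defs
begin

section \<open>A Hoare logic with time and word size bounds\<close>

text \<open>The running time may depend on the number \<open>M\<close> of 1-entries of both factors,
  but not on the dimension \<open>n\<close>, which can be far larger. Hence the nodes are the
  \<open>2 * M\<close> positions in the flattened input, and the \<open>3 * n\<close> cells of the
  renaming table are never scanned or cleared: a cell is read only after it has been written.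
  \<open>n\<close> enters through addresses alone, which is harmless because it is itself an input
  word. Rows, middle indices and columns get separate nodes, since otherwise two arcs of the same
  matrix could be composed by the query. The time bound carries over because the answers correspond
  one to one to the 1-entries of the product, and because a fixed query turns \<open>f\<close> into
  the constant \<open>f 3\<close>. The word limit is a power without a constant factor, so the
  larger Eval input has to be paid for in the exponent. Memory beyond the table is still 0 when the
  graph is written; this supplies both the counters of the sort and the blank memory that the Eval
  program expects.\<close>

definition run :: "instr list \<Rightarrow> nat \<Rightarrow> nat \<Rightarrow> config \<Rightarrow> config \<Rightarrow> bool" where
  "run P b t s s' \<longleftrightarrow> (step P ^^ t) s = s' \<and> (\<forall>t'\<le>t. fits b ((step P ^^ t') s))"

lemma run_0: "fits b s \<Longrightarrow> run P b 0 s s"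
  by (simp add: run_def)

lemma run_fits: "run P b t s s' \<Longrightarrow> fits b s'"
  by (auto simp: run_def)

lemma run_trans:
  assumes "run P b t s s'" "run P b u s' s''"
  shows "run P b (t + u) s s''"
proof -
  have add: "(step P ^^ (t + v)) s = (step P ^^ v) s'" for v
    using assms(1) by (simp add: run_def add.commute[of t] funpow_add)
  have "fits b ((step P ^^ v) s)" if "v \<le> t + u" for v
  proof (cases "v \<le> t")
    case True
    then show ?thesis using assms(1) by (simp add: run_def)
  next
    case False
    then have "v = t + (v - t)" "v - t \<le> u" using that by auto
    then show ?thesis using assms(2) add[of "v - t"] by (simp add: run_def)
  qed
  then show ?thesis using assms(2) add[of u] by (simp add: run_def)
qed

lemma run_step: "\<lbrakk>fits b s; step P s = s'; fits b s'\<rbrakk> \<Longrightarrow> run P b 1 s s'"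
  by (auto simp: run_def le_Suc_eq)

text \<open>
  A code fragment is a function of the position at which it is placed, because jump targets are
  absolute. Assertions speak about the registers and the memory.
\<close>

definition triple ::
    "nat \<Rightarrow> ((nat \<Rightarrow> nat) \<Rightarrow> (nat \<Rightarrow> nat) \<Rightarrow> bool) \<Rightarrow> (nat \<Rightarrow> instr list) \<Rightarrow> nat \<Rightarrow>
      ((nat \<Rightarrow> nat) \<Rightarrow> (nat \<Rightarrow> nat) \<Rightarrow> bool) \<Rightarrow> bool" where
  "triple b Q F T Q' \<longleftrightarrow>
     (\<forall>xs ys s. pc s = length xs \<longrightarrow> fits b s \<longrightarrow> Q (reg s) (mem s) \<longrightarrow>
        (\<exists>t s'. t \<le> T \<and> run (xs @ F (length xs) @ ys) b t s s' \<and>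
           pc s' = length xs + length (F (length xs)) \<and> Q' (reg s') (mem s')))"

lemma triple_mono:
  assumes "triple b Q F T Q'" "T \<le> T'" "\<And>r m. Q0 r m \<Longrightarrow> Q r m" "\<And>r m. Q' r m \<Longrightarrow> Q1 r m"
  shows "triple b Q0 F T' Q1"
  using assms unfolding triple_def by (meson le_trans)

definition seq :: "(nat \<Rightarrow> instr list) \<Rightarrow> (nat \<Rightarrow> instr list) \<Rightarrow> nat \<Rightarrow> instr list" (infixr \<open>;;\<close> 60)
  where "(F ;; G) p = F p @ G (p + length (F p))"

lemma triple_seq:
  assumes F: "triple b Q F T Q'" and G: "triple b Q' G T' Q''"
  shows "triple b Q (F ;; G) (T + T') Q''"
  unfolding triple_def
proof (intro allI impI)
  fix xs ys :: "instr list" and s :: config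
  assume s: "pc s = length xs" "fits b s" "Q (reg s) (mem s)"
  let ?f = "F (length xs)" let ?g = "G (length xs + length ?f)"
  obtain t s' where t: "t \<le> T" "run (xs @ ?f @ (?g @ ys)) b t s s'"
    "pc s' = length (xs @ ?f)" "Q' (reg s') (mem s')"
    using F s unfolding triple_def by (metis length_append)
  obtain u s'' where u: "u \<le> T'" "run ((xs @ ?f) @ ?g @ ys) b u s' s''"
    "pc s'' = length (xs @ ?f) + length ?g" "Q'' (reg s'') (mem s'')"
    using G t run_fits[OF t(2)] unfolding triple_def by (metis length_append)
  have "run (xs @ (F ;; G) (length xs) @ ys) b (t + u) s s''"
    using run_trans[OF t(2), of u s''] u(2) by (simp add: seq_def)
  then show "\<exists>t s''. t \<le> T + T' \<and> run (xs @ (F ;; G) (length xs) @ ys) b t s s'' \<and>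
      pc s'' = length xs + length ((F ;; G) (length xs)) \<and> Q'' (reg s'') (mem s'')"
    using t(1) u by (intro exI[of _ "t + u"] exI[of _ s'']) (auto simp: seq_def)
qed

definition straight :: "instr list \<Rightarrow> nat \<Rightarrow> instr list" where
  "straight is p = is"

text \<open>Loads and stores only move values around, so they have no word size condition.\<close>

fun wp :: "nat \<Rightarrow> instr list \<Rightarrow> ((nat \<Rightarrow> nat) \<Rightarrow> (nat \<Rightarrow> nat) \<Rightarrow> bool) \<Rightarrow>
    (nat \<Rightarrow> nat) \<Rightarrow> (nat \<Rightarrow> nat) \<Rightarrow> bool" where
  "wp b [] Q r m = Q r m"
| "wp b (Const x k # is) Q r m = (k < b \<and> wp b is Q (r(x := k)) m)"
| "wp b (Bin f x y z # is) Q r m =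
     (eval_binop f (r y) (r z) < b \<and> wp b is Q (r(x := eval_binop f (r y) (r z))) m)"
| "wp b (Load x y # is) Q r m = wp b is Q (r(x := m (r y))) m"
| "wp b (Store x y # is) Q r m = wp b is Q r (m(r x := r y))"
| "wp b (Jump l # is) Q r m = False"
| "wp b (JumpZero x l # is) Q r m = False"

lemma wp_run:
  assumes "pc s = length xs" "fits b s" "wp b is Q (reg s) (mem s)"
  shows "\<exists>s'. run (xs @ is @ ys) b (length is) s s' \<and> pc s' = length xs + length is \<and>
    Q (reg s') (mem s')"
  using assms
proof (induction "is" arbitrary: xs s)
  case Nil
  then show ?case by (auto intro: run_0)
next
  case (Cons i "is")
  let ?s = "exec i s"
  have step: "step (xs @ (i # is) @ ys) s = ?s"
    using Cons.prems(1) by (simp add: step_def halted_def)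
  have s: "pc ?s = length (xs @ [i])" "fits b ?s" "wp b is Q (reg ?s) (mem ?s)"
    using Cons.prems by (cases i; auto simp: fits_def)+
  obtain s' where s': "run (xs @ (i # is) @ ys) b (length is) ?s s'"
    "pc s' = length (xs @ [i]) + length is" "Q (reg s') (mem s')"
    using Cons.IH[OF s] by auto
  have "run (xs @ (i # is) @ ys) b (1 + length is) s s'"
    using run_trans[OF run_step[OF Cons.prems(2) step s(2)] s'(1)] .
  then show ?case using s' by auto
qed

lemma triple_straight:
  assumes "\<And>r m. Q r m \<Longrightarrow> wp b is Q' r m"
  shows "triple b Q (straight is) (length is) Q'"
  unfolding triple_def straight_def using wp_run assms by blast

definition loop :: "nat \<Rightarrow> (nat \<Rightarrow> instr list) \<Rightarrow> nat \<Rightarrow> instr list" where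
  "loop x F p =
     [JumpZero x (p + length (F (Suc p)) + 2)] @ F (Suc p) @ [Jump p]"

text \<open>The body itself lowers the counter \<open>x\<close> by one, and the invariant is indexed
  by the counter, so induction on \<open>k\<close> suffices. A round costs \<open>T\<close> plus the
  test and the jump back; the failing last test is the extra step.\<close>

lemma triple_loop:
  assumes body: "\<And>j. j < k \<Longrightarrow>
    triple b (\<lambda>r m. r x = Suc j \<and> I (Suc j) r m) F T (\<lambda>r m. r x = j \<and> I j r m)"
  shows "triple b (\<lambda>r m. r x = k \<and> I k r m) (loop x F) (k * (T + 2) + 1) (I 0)"
  using assms
proof (induction k)
  case 0
  show ?case
    unfolding triple_def
  proof (intro allI impI)
    fix xs ys :: "instr list" and s :: config
    assume s: "pc s = length xs" "fits b s" "reg s x = 0 \<and> I 0 (reg s) (mem s)"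
    let ?P = "xs @ loop x F (length xs) @ ys"
    let ?s = "s\<lparr>pc := length xs + length (loop x F (length xs))\<rparr>"
    have "step ?P s = ?s"
      using s by (simp add: step_def halted_def loop_def)
    moreover have "fits b ?s" using s(2) by (simp add: fits_def)
    ultimately have "run ?P b 1 s ?s" using s(2) run_step by blast
    then show "\<exists>t s'. t \<le> 0 * (T + 2) + 1 \<and> run ?P b t s s' \<and>
        pc s' = length xs + length (loop x F (length xs)) \<and> I 0 (reg s') (mem s')"
      using s by (intro exI[of _ 1] exI[of _ ?s]) auto
  qed
next
  case (Suc k)
  have IH: "triple b (\<lambda>r m. r x = k \<and> I k r m) (loop x F) (k * (T + 2) + 1) (I 0)"
    using Suc by simp
  show ?case
    unfolding triple_def
  proof (intro allI impI)
    fix xs ys :: "instr list" and s :: config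
    assume s: "pc s = length xs" "fits b s" "reg s x = Suc k \<and> I (Suc k) (reg s) (mem s)"
    let ?F = "F (Suc (length xs))"
    let ?P = "xs @ loop x F (length xs) @ ys"
    let ?j = "JumpZero x (length xs + length ?F + 2)"
    have P: "?P = (xs @ [?j]) @ ?F @ (Jump (length xs) # ys)" by (simp add: loop_def)
    let ?s1 = "s\<lparr>pc := Suc (pc s)\<rparr>"
    have "step ?P s = ?s1"
      using s by (simp add: step_def halted_def loop_def)
    moreover have f1: "fits b ?s1" using s(2) by (simp add: fits_def)
    ultimately have r1: "run ?P b 1 s ?s1" using s(2) run_step by blast
    obtain t s2 where s2: "t \<le> T" "run ((xs @ [?j]) @ ?F @ (Jump (length xs) # ys)) b t ?s1 s2"
      "pc s2 = length (xs @ [?j]) + length ?F" "reg s2 x = k \<and> I k (reg s2) (mem s2)"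
    proof -
      have "pc ?s1 = length (xs @ [?j])" "reg ?s1 x = Suc k \<and> I (Suc k) (reg ?s1) (mem ?s1)"
        using s by auto
      then show ?thesis
        using Suc.prems[of k, unfolded triple_def, rule_format, of ?s1 "xs @ [?j]"] f1 that
        by auto
    qed
    let ?s3 = "s2\<lparr>pc := length xs\<rparr>"
    have "step ?P s2 = ?s3"
      unfolding P using s2(3) by (simp add: step_def halted_def nth_append)
    moreover have f2: "fits b s2" using run_fits[OF s2(2)] .
    moreover have f3: "fits b ?s3" using f2 by (simp add: fits_def)
    ultimately have r3: "run ?P b 1 s2 ?s3" using run_step by blast
    obtain u s4 where s4: "u \<le> k * (T + 2) + 1" "run ?P b u ?s3 s4"
      "pc s4 = length xs + length (loop x F (length xs))" "I 0 (reg s4) (mem s4)"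
      using IH[unfolded triple_def, rule_format, of ?s3 xs ys] f3 s2(4) by auto
    have "run ?P b (1 + t + 1 + u) s s4"
      using run_trans[OF run_trans[OF run_trans[OF r1 s2(2)[folded P]] r3] s4(2)] .
    then show "\<exists>t s'. t \<le> Suc k * (T + 2) + 1 \<and> run ?P b t s s' \<and>
        pc s' = length xs + length (loop x F (length xs)) \<and> I 0 (reg s') (mem s')"
      using s2(1) s4 by (intro exI[of _ "1 + t + 1 + u"] exI[of _ s4]) auto
  qed
qed

section \<open>Relocating a program\<close>

text \<open>
  Register 0 is scratch space and register 1 holds the address that plays the role of address 0.
  Every instruction becomes two, so that jump targets are easy to translate.
\<close>

fun reloc :: "nat \<Rightarrow> nat \<Rightarrow> nat \<Rightarrow> instr \<Rightarrow> instr list" where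
  "reloc d p l (Const x k) = [Const 0 0, Const (x + d) k]"
| "reloc d p l (Bin f x y z) = [Const 0 0, Bin f (x + d) (y + d) (z + d)]"
| "reloc d p l (Load x y) = [Bin Add 0 (y + d) 1, Load (x + d) 0]"
| "reloc d p l (Store x y) = [Bin Add 0 (x + d) 1, Store 0 (y + d)]"
| "reloc d p l (Jump k) = [Const 0 0, Jump (p + 2 * min k l)]"
| "reloc d p l (JumpZero x k) = [Const 0 0, JumpZero (x + d) (p + 2 * min k l)]"

text \<open>Instruction \<open>k\<close> starts exactly at \<open>p + 2 * k\<close>. As
  \<open>reloc\<close> clamps jump targets by \<open>min k l\<close>, every way of leaving
  \<open>P\<close> leads to the first position after the fragment.\<close>

definition relocate :: "nat \<Rightarrow> instr list \<Rightarrow> nat \<Rightarrow> instr list" where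
  "relocate d P p =
     map (\<lambda>j. reloc d p (length P) (P ! (j div 2)) ! (j mod 2)) [0..<2 * length P]"

text \<open>\<open>r0\<close> and \<open>m0\<close> are the state of the host program, frozen below
  register \<open>d\<close> and below cell \<open>V\<close>, so that its constants and the original
  input survive the simulation. Register 0 is exempt because the address computations overwrite
  it.\<close>

definition simulates ::
    "nat \<Rightarrow> nat \<Rightarrow> (nat \<Rightarrow> nat) \<Rightarrow> (nat \<Rightarrow> nat) \<Rightarrow> config \<Rightarrow> (nat \<Rightarrow> nat) \<Rightarrow> (nat \<Rightarrow> nat) \<Rightarrow> bool" where
  "simulates d V r0 m0 s r m \<longleftrightarrow>
     (\<forall>x. r (x + d) = reg s x) \<and> (\<forall>x<d. x \<noteq> 0 \<longrightarrow> r x = r0 x) \<and>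
     (\<forall>a. m (V + a) = mem s a) \<and> (\<forall>a<V. m a = m0 a)"

text \<open>A simulated address is a register content below \<open>b'\<close>, to which
  \<open>V\<close> is added in register 0; this is why \<open>V + b'\<close> has to stay within
  \<open>b\<close>.\<close>

lemma relocate_step:
  assumes d: "2 \<le> d" and V: "r0 1 = V"
    and b: "V + b' \<le> b" and fits': "fits b' s" "fits b' (step P s)"
    and nh: "\<not> halted P s"
    and sim: "simulates d V r0 m0 s (reg u) (mem u)"
    and pc: "pc u = length xs + 2 * min (pc s) (length P)" and fu: "fits b u"
  shows "\<exists>u'. run (xs @ relocate d P (length xs) @ ys) b 2 u u' \<and>
    simulates d V r0 m0 (step P s) (reg u') (mem u') \<and>
    pc u' = length xs + 2 * min (pc (step P s)) (length P)"
proof -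
  let ?i = "P ! pc s" let ?Q = "xs @ relocate d P (length xs) @ ys"
  let ?c = "reloc d (length xs) (length P) ?i"
  have lt: "pc s < length P" using nh by (simp add: halted_def)
  have st: "step P s = exec ?i s" using nh by (simp add: step_def)
  have pcu: "pc u = length xs + 2 * pc s" using pc lt by simp
  have len: "length (relocate d P (length xs)) = 2 * length P" by (simp add: relocate_def)
  have n0: "?Q ! pc u = ?c ! 0" "pc u < length ?Q"
    using lt pcu len by (auto simp: nth_append relocate_def)
  have n1: "?Q ! Suc (pc u) = ?c ! 1" "Suc (pc u) < length ?Q"
    using lt pcu len by (auto simp: nth_append relocate_def)
  define u1 where "u1 = exec (?c ! 0) u"
  define u2 where "u2 = exec (?c ! 1) u1"
  have s1: "step ?Q u = u1" using n0 by (simp add: step_def halted_def u1_def)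
  have pc1: "pc u1 = Suc (pc u)" unfolding u1_def by (cases ?i) auto
  have s2: "step ?Q u1 = u2" using n1 pc1 by (simp add: step_def halted_def u2_def)
  have r1: "reg u 1 = V" using sim d V by (simp add: simulates_def)
  have R: "reg u (x + d) = reg s x" "reg s x < b'" for x
    using sim fits'(1) by (auto simp: simulates_def fits_def)
  have M: "mem u (V + a) = mem s a" "mem s a < b'" for a
    using sim fits'(1) by (auto simp: simulates_def fits_def)
  have F: "reg u x < b" "mem u a < b" for x a using fu by (auto simp: fits_def)
  have b0: "0 < b" using F(1)[of 0] by linarith
  have f1: "fits b u1"
    using F b0 R r1 b d unfolding u1_def
    by (cases ?i) (auto simp: fits_def add_less_mono intro: less_le_trans[OF _ b])
  have E: "reg (exec ?i s) x < b'" "mem (exec ?i s) a < b'" for x a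
    using fits'(2) st by (auto simp: fits_def)
  have bb: "x < b' \<Longrightarrow> x < b" for x using b by linarith
  have sim2: "simulates d V r0 m0 (exec ?i s) (reg u2) (mem u2)"
    using sim d r1 unfolding u2_def u1_def
    by (cases ?i) (auto simp: simulates_def add.commute)
  have f2: "fits b u2"
  proof (cases ?i)
    case (Const x k)
    then show ?thesis using f1 E(1)[of x] bb unfolding u2_def by (auto simp: fits_def)
  next
    case (Bin f x y z)
    then show ?thesis using f1 E(1)[of x] bb R d unfolding u2_def u1_def by (auto simp: fits_def)
  next
    case (Load x y)
    then show ?thesis using f1 unfolding u2_def by (auto simp: fits_def)
  next
    case (Store x y)
    then show ?thesis using f1 unfolding u2_def by (auto simp: fits_def)
  next
    case (Jump k)
    then show ?thesis using f1 unfolding u2_def by (auto simp: fits_def)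
  next
    case (JumpZero x k)
    then show ?thesis using f1 unfolding u2_def by (auto simp: fits_def)
  qed
  have pc2: "pc u2 = length xs + 2 * min (pc (exec ?i s)) (length P)"
    using lt pc1 pcu R(1) d unfolding u2_def u1_def by (cases ?i) auto
  have "run ?Q b (1 + 1) u u2"
    using run_trans[OF run_step[OF fu s1 f1] run_step[OF f1 s2 f2]] .
  then show ?thesis using sim2 pc2 st by (auto simp: numeral_2_eq_2)
qed

lemma triple_relocate:
  assumes d: "2 \<le> d" and V: "r0 1 = V" and b: "V + b' \<le> b"
    and run: "run P b' t s s'" and halt: "halted P s'" and s: "pc s = 0"
  shows "triple b (simulates d V r0 m0 s) (relocate d P) (2 * t) (simulates d V r0 m0 s')"
  unfolding triple_def
proof (intro allI impI)
  fix xs ys :: "instr list" and u :: config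
  assume u: "pc u = length xs" "fits b u" "simulates d V r0 m0 s (reg u) (mem u)"
  let ?Q = "xs @ relocate d P (length xs) @ ys"
  \<comment> \<open>Only an upper bound on \<open>k\<close>: once \<open>P\<close> has halted, its
    further steps are idle and the relocated program takes none.\<close>
  have "\<exists>k u'. k \<le> 2 * v \<and> run ?Q b k u u' \<and>
      simulates d V r0 m0 ((step P ^^ v) s) (reg u') (mem u') \<and>
      pc u' = length xs + 2 * min (pc ((step P ^^ v) s)) (length P)" if "v \<le> t" for v
    using that
  proof (induction v)
    case 0
    then show ?case using u s by (intro exI[of _ 0] exI[of _ u]) (auto intro: run_0)
  next
    case (Suc v)
    let ?s = "(step P ^^ v) s"
    obtain k u' where k: "k \<le> 2 * v" "run ?Q b k u u'"
      "simulates d V r0 m0 ?s (reg u') (mem u')"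
      "pc u' = length xs + 2 * min (pc ?s) (length P)"
      using Suc by auto
    have f: "fits b' ?s" "fits b' (step P ?s)"
      using run Suc.prems unfolding run_def by (auto dest: spec[of _ v] spec[of _ "Suc v"])
    show ?case
    proof (cases "halted P ?s")
      case True
      then have "step P ?s = ?s" by (simp add: step_def)
      then show ?thesis using k by (intro exI[of _ k] exI[of _ u']) auto
    next
      case False
      obtain u'' where u'': "run ?Q b 2 u' u''"
        "simulates d V r0 m0 (step P ?s) (reg u'') (mem u'')"
        "pc u'' = length xs + 2 * min (pc (step P ?s)) (length P)"
        using relocate_step[OF d V b f False k(3,4) run_fits[OF k(2)]] by blast
      show ?thesis
        using run_trans[OF k(2) u''(1)] u'' k(1)
        by (intro exI[of _ "k + 2"] exI[of _ u'']) auto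
    qed
  qed
  from this[of t] show "\<exists>k u'. k \<le> 2 * t \<and> run ?Q b k u u' \<and>
      pc u' = length xs + length (relocate d P (length xs)) \<and>
      simulates d V r0 m0 s' (reg u') (mem u')"
    using run halt by (auto simp: run_def halted_def relocate_def)
qed

section \<open>Counting sort\<close>

definition cnt :: "(nat \<Rightarrow> bool) \<Rightarrow> nat \<Rightarrow> nat" where
  "cnt Q k = length (filter Q [0..<k])"

lemma cnt_simps [simp]: "cnt Q 0 = 0" "cnt Q (Suc k) = cnt Q k + (if Q k then 1 else 0)"
  by (auto simp: cnt_def)

lemma cnt_le: "cnt Q k \<le> k"
  by (induction k) auto

lemma cnt_all: "(\<And>e. e < k \<Longrightarrow> Q e) \<Longrightarrow> cnt Q k = k"
  by (induction k) auto

lemma cnt_none: "(\<And>e. e < k \<Longrightarrow> \<not> Q e) \<Longrightarrow> cnt Q k = 0"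
  by (induction k) auto

lemma cnt_less_Suc: "cnt (\<lambda>e. f e < Suc t) k = cnt (\<lambda>e. f e < t) k + cnt (\<lambda>e. f e = t) k"
  by (induction k) auto

definition bucket :: "(nat \<Rightarrow> nat) \<Rightarrow> nat \<Rightarrow> nat \<Rightarrow> nat list" where
  "bucket f k t = filter (\<lambda>e. f e = t) [0..<k]"

text \<open>The position of \<open>e\<close> when \<open>[0..<k]\<close> is sorted stably by
  \<open>f\<close>.\<close>

definition rank :: "(nat \<Rightarrow> nat) \<Rightarrow> nat \<Rightarrow> nat \<Rightarrow> nat" where
  "rank f k e = cnt (\<lambda>e'. f e' < f e) k + cnt (\<lambda>e'. f e' = f e) e"

definition count_sort :: "(nat \<Rightarrow> nat) \<Rightarrow> nat \<Rightarrow> nat \<Rightarrow> nat list" where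
  "count_sort f k t = concat (map (bucket f k) [0..<t])"

lemma length_count_sort: "length (count_sort f k t) = cnt (\<lambda>e. f e < t) k"
proof (induction t)
  case 0
  then show ?case using cnt_none by (auto simp: count_sort_def)
next
  case (Suc t)
  then show ?case by (simp add: count_sort_def cnt_less_Suc) (simp add: cnt_def bucket_def)
qed

lemma set_count_sort: "set (count_sort f k t) \<subseteq> {..<k}"
  by (auto simp: count_sort_def bucket_def)

text \<open>Cut the list of buckets before bucket \<open>f e\<close>, and this bucket before
  \<open>e\<close>: the two summands of \<open>rank\<close> are the lengths of the pieces in front
  of \<open>e\<close>.\<close>

lemma nth_count_sort:
  assumes "e < k" "f e < t"
  shows "rank f k e < length (count_sort f k t)" "count_sort f k t ! rank f k e = e"
proof -
  have t: "[0..<t] = [0..<f e] @ f e # [Suc (f e)..<t]"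
    using assms(2) by (metis le_add_diff_inverse less_imp_le upt_add_eq_append upt_conv_Cons zero_le)
  have k: "[0..<k] = [0..<e] @ e # [Suc e..<k]"
    using assms(1) by (metis le_add_diff_inverse less_imp_le upt_add_eq_append upt_conv_Cons zero_le)
  obtain ys where "count_sort f k t = (count_sort f k (f e) @ filter (\<lambda>e'. f e' = f e) [0..<e]) @ e # ys"
    unfolding count_sort_def t by (simp add: bucket_def) (simp add: k)
  moreover have "rank f k e = length (count_sort f k (f e) @ filter (\<lambda>e'. f e' = f e) [0..<e])"
    by (simp add: rank_def length_count_sort) (simp add: cnt_def)
  ultimately show "rank f k e < length (count_sort f k t)" "count_sort f k t ! rank f k e = e"
    by (auto simp: nth_append)
qed

text \<open>Looking up the sorted list inverts \<open>rank\<close>, and an injective map of a finite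
  set into itself is onto. Injectivity means that no arc overwrites another one, surjectivity that
  no cell of the arc block is left out.\<close>

lemma rank_bij:
  assumes "\<And>e. e < k \<Longrightarrow> f e < t"
  shows "bij_betw (rank f k) {..<k} {..<k}"
proof -
  have len: "length (count_sort f k t) = k"
    using assms by (simp add: length_count_sort cnt_all)
  have "inj_on (rank f k) {..<k}"
    using nth_count_sort(2)[of _ k f t] assms by (metis inj_onI lessThan_iff)
  moreover have "rank f k ` {..<k} \<subseteq> {..<k}"
    using nth_count_sort(1)[of _ k f t] assms len by auto
  ultimately show ?thesis
    by (simp add: bij_betw_def endo_inj_surj)
qed

section \<open>From matrices to graphs\<close>

lemma length_flatten [simp]: "length (flatten_pairs ps) = 2 * length ps"
  by (induction ps) auto

lemma flatten_append: "flatten_pairs (ps @ qs) = flatten_pairs ps @ flatten_pairs qs"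
  by (induction ps rule: flatten_pairs.induct) auto

lemma nth_flatten:
  "e < length ps \<Longrightarrow> flatten_pairs ps ! (2 * e) = fst (ps ! e)"
  "e < length ps \<Longrightarrow> flatten_pairs ps ! Suc (2 * e) = snd (ps ! e)"
  by (induction ps arbitrary: e rule: flatten_pairs.induct) (auto simp: nth_Cons split: nat.splits)

lemma set_flatten: "set (flatten_pairs ps) = fst ` set ps \<union> snd ` set ps"
  by (induction ps rule: flatten_pairs.induct) auto

text \<open>
  The nodes of the graph are the positions in the flattened list of entries, and every row,
  middle or column index is identified with the first position at which it occurs. The three
  kinds of indices are told apart by \<open>cls\<close>, which uses truncated subtraction.
\<close>

locale sbmm_lists =
  fixes n :: nat and as bs :: "(nat \<times> nat) list"
  assumes distinct: "distinct as" "distinct bs"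
    and range: "set as \<subseteq> {..<n} \<times> {..<n}" "set bs \<subseteq> {..<n} \<times> {..<n}"
begin

definition M :: nat where "M = length as + length bs"

definition wd :: "nat \<Rightarrow> nat" where "wd t = flatten_pairs (as @ bs) ! t"

text \<open>The truncated term is 0 on the positions of \<open>as\<close> and 1 on those of
  \<open>bs\<close>. Thus rows get 0, middle indices 1 in both lists, and columns 2.\<close>

definition cls :: "nat \<Rightarrow> nat" where "cls t = t mod 2 + (1 - (2 * length as - t))"

definition key :: "nat \<Rightarrow> nat" where "key t = wd t + n * cls t"

text \<open>The minimum ranges over all numbers, even those where \<open>wd\<close> reads past the
  list; since \<open>t\<close> itself qualifies, the minimum is at most \<open>t\<close> and hence
  in range.\<close>

definition rep :: "nat \<Rightarrow> nat" where "rep t = (LEAST t'. key t' = key t)"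

definition src :: "nat \<Rightarrow> nat" where "src e = rep (2 * e)"

definition dst :: "nat \<Rightarrow> nat" where "dst e = rep (Suc (2 * e))"

lemma wd_less: "t < 2 * M \<Longrightarrow> wd t < n"
proof -
  assume "t < 2 * M"
  then have "wd t \<in> set (flatten_pairs (as @ bs))" by (simp add: wd_def M_def)
  then show "wd t < n" using range by (auto simp: set_flatten)
qed

lemma wd_pair: "e < M \<Longrightarrow> (wd (2 * e), wd (Suc (2 * e))) = (as @ bs) ! e"
  by (simp add: wd_def M_def nth_flatten)

lemma cls_le: "cls t \<le> 2"
  unfolding cls_def by linarith

lemma key_less: "t < 2 * M \<Longrightarrow> key t < 3 * n"
  using wd_less[of t] mult_le_mono2[OF cls_le[of t], of n] unfolding key_def by linarith

lemma key_eq: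
  assumes "t < 2 * M" "t' < 2 * M"
  shows "key t = key t' \<longleftrightarrow> wd t = wd t' \<and> cls t = cls t'"
proof
  assume eq: "key t = key t'"
  \<comment> \<open>Because \<open>wd\<close> is below \<open>n\<close>, \<open>key\<close> is a
    two-digit number in base \<open>n\<close> with digits \<open>cls\<close> and
    \<open>wd\<close>.\<close>
  have "key t div n = cls t" "key t mod n = wd t" "key t' div n = cls t'" "key t' mod n = wd t'"
    using wd_less[OF assms(1)] wd_less[OF assms(2)] by (auto simp: key_def)
  then show "wd t = wd t' \<and> cls t = cls t'" using eq by metis
qed (simp add: key_def)

lemma key_rep: "key (rep t) = key t"
  unfolding rep_def by (rule LeastI) simp

lemma rep_le: "rep t \<le> t"
  unfolding rep_def by (rule Least_le) simp

lemma rep_eq: "rep t = rep t' \<longleftrightarrow> key t = key t'"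
  using key_rep by (metis rep_def)

lemma wd_cls_rep:
  assumes "t < 2 * M"
  shows "wd (rep t) = wd t" "cls (rep t) = cls t"
  using key_eq[of "rep t" t] rep_le[of t] key_rep assms by auto

lemma src_less: "e < M \<Longrightarrow> src e < 2 * M" and dst_less: "e < M \<Longrightarrow> dst e < 2 * M"
  using rep_le[of "2 * e"] rep_le[of "Suc (2 * e)"] by (auto simp: src_def dst_def)

lemma cls_pair:
  "cls (2 * e) = (if e < length as then 0 else 1)"
  "cls (Suc (2 * e)) = (if e < length as then 1 else 2)"
  by (auto simp: cls_def Suc_double_not_eq_double)

text \<open>The class of the source reveals which list the arc comes from, and each list is
  distinct. So the adjacency lists contain no repetitions.\<close>

lemma arc_inj:
  assumes "e < M" "e' < M" "src e = src e'" "dst e = dst e'"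
  shows "e = e'"
proof -
  have "key (2 * e) = key (2 * e')" "key (Suc (2 * e)) = key (Suc (2 * e'))"
    using assms(3,4) by (auto simp: src_def dst_def rep_eq)
  then have k: "(as @ bs) ! e = (as @ bs) ! e'" "cls (2 * e) = cls (2 * e')"
    using assms(1,2) by (auto simp: key_eq simp flip: wd_pair)
  show ?thesis
    using k distinct assms(1,2)
    by (auto simp: cls_pair nth_append M_def nth_eq_iff_index_eq split: if_splits)
qed

definition db :: "'a \<Rightarrow> (nat, 'a) graph_db" where
  "db z = \<lparr>nodes = {..<2 * M}, arcs = {(src e, z, dst e) | e. e < M}\<rparr>"

definition adj :: "'a \<Rightarrow> ('a \<times> nat) list list" where
  "adj z = map (\<lambda>t. map (\<lambda>e. (z, dst e)) (bucket src M t)) [0..<2 * M]"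

definition query :: "'a \<Rightarrow> 'a rpq" where
  "query z = Cat (Sym z) (Sym z)"

lemma graph_database_db: "graph_database (db z)"
  using src_less dst_less by (auto simp: graph_database_def db_def)

lemma adjacency_lists_db: "adjacency_lists (db z) [0..<2 * M] (adj z)"
proof -
  have "distinct (adj z ! i)" if "i < 2 * M" for i
    using that arc_inj by (auto simp: adj_def distinct_map bucket_def intro!: inj_onI)
  moreover have "set (adj z ! i) = {(a, j). j < 2 * M \<and> (i, a, j) \<in> arcs (db z)}" if "i < 2 * M" for i
    using that dst_less by (auto simp: adj_def bucket_def db_def)
  ultimately show ?thesis
    by (auto simp: adjacency_lists_def db_def adj_def)
qed

lemma db_size_db: "db_size (db z) \<le> 2 * M"
proof -
  have "arcs (db z) = (\<lambda>e. (src e, z, dst e)) ` {..<M}" by (auto simp: db_def)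
  then have "card (arcs (db z)) \<le> M" by (metis card_image_le card_lessThan finite_lessThan)
  then show ?thesis by (simp add: db_size_def db_def)
qed

lemma result_db:
  "rpq_result (query z) (db z) = {(src e, dst e') | e e'. e < M \<and> e' < M \<and> dst e = src e'}"
    (is "?L = ?R")
proof
  show "?L \<subseteq> ?R"
    by (auto simp: rpq_result_def query_def is_path_def db_def less_Suc_eq) metis
  show "?R \<subseteq> ?L"
  proof
    fix p assume "p \<in> ?R"
    then obtain e e' where e: "e < M" "e' < M" "dst e = src e'" "p = (src e, dst e')" by blast
    have "is_path (db z) (src e) [src e, dst e, dst e'] [z, z] (dst e')"
      using e src_less dst_less by (auto simp: is_path_def db_def less_Suc_eq)
    moreover have "[z, z] \<in> lang (query z)" by (simp add: query_def)
    moreover have "src e \<in> nodes (db z)" "dst e' \<in> nodes (db z)"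
      using e src_less dst_less by (auto simp: db_def)
    ultimately show "p \<in> ?L"
      unfolding rpq_result_def e(4) by blast
  qed
qed

lemma result_less: "(u, v) \<in> rpq_result q (db z) \<Longrightarrow> u < 2 * M \<and> v < 2 * M"
  by (simp add: rpq_result_def db_def)

abbreviation index_pair :: "nat \<times> nat \<Rightarrow> nat \<times> nat" where
  "index_pair p \<equiv> (wd (fst p), wd (snd p))"

text \<open>Targets have class 1 or 2 and sources 0 or 1, so only middle indices can link two arcs,
  and the first arc must come from \<open>as\<close>, the second from \<open>bs\<close>.\<close>

lemma dst_eq_src:
  assumes "e < M" "e' < M"
  shows "dst e = src e' \<longleftrightarrow> e < length as \<and> length as \<le> e' \<and> wd (Suc (2 * e)) = wd (2 * e')"
  using assms by (auto simp: src_def dst_def rep_eq key_eq cls_pair)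

text \<open>Answers lead from class 0 to class 2, and with the class fixed the index determines the
  node. This gives both the size of the answer set and a translated output without
  repetitions.\<close>

lemma inj_result: "inj_on index_pair (rpq_result (query z) (db z))"
proof (rule inj_onI)
  fix p p'
  assume "p \<in> rpq_result (query z) (db z)" "p' \<in> rpq_result (query z) (db z)"
    and w: "index_pair p = index_pair p'"
  then obtain e f e' f' where e: "e < M" "f < M" "dst e = src f" "p = (src e, dst f)"
    "e' < M" "f' < M" "dst e' = src f'" "p' = (src e', dst f')"
    by (auto simp: result_db)
  have "key (2 * e) = key (2 * e')" "key (Suc (2 * f)) = key (Suc (2 * f'))"
    using e w
    by (auto simp: dst_eq_src key_eq cls_pair) (auto simp: src_def dst_def wd_cls_rep)
  then show "p = p'" using e by (simp add: src_def dst_def rep_eq)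
qed

lemma image_result:
  assumes as: "set as = one_entries n A" and bs: "set bs = one_entries n B"
  shows "index_pair ` rpq_result (query z) (db z) = one_entries n (bool_matrix_mult n A B)"
proof -
  have "index_pair ` rpq_result (query z) (db z) =
      {(wd (2 * e), wd (Suc (2 * e'))) | e e'. e < M \<and> e' < M \<and> dst e = src e'}"
    by (force simp: result_db src_def dst_def wd_cls_rep image_iff)
  also have "\<dots> = {(i, j). \<exists>k. (i, k) \<in> set as \<and> (k, j) \<in> set bs}" (is "?L = ?R")
  proof
    show "?L \<subseteq> ?R"
    proof
      fix p assume "p \<in> ?L"
      then obtain e e' where e: "e < M" "e' < M" "dst e = src e'"
        "p = (wd (2 * e), wd (Suc (2 * e')))" by blast
      then have e': "e < length as" "length as \<le> e'" "wd (Suc (2 * e)) = wd (2 * e')"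
        by (auto simp: dst_eq_src)
      have "(wd (2 * e), wd (Suc (2 * e))) \<in> set as" "(wd (2 * e'), wd (Suc (2 * e'))) \<in> set bs"
        using wd_pair[of e] wd_pair[of e'] e e' by (auto simp: nth_append M_def)
      then show "p \<in> ?R" using e e' by auto
    qed
    show "?R \<subseteq> ?L"
    proof
      fix p assume "p \<in> ?R"
      then obtain i j k where p: "p = (i, j)" "(i, k) \<in> set as" "(k, j) \<in> set bs" by auto
      obtain e f where e: "e < length as" "as ! e = (i, k)" "f < length bs" "bs ! f = (k, j)"
        using p by (metis in_set_conv_nth)
      let ?f = "length as + f"
      have "e < M" "?f < M" using e by (auto simp: M_def)
      moreover have "(wd (2 * e), wd (Suc (2 * e))) = (i, k)"
        "(wd (2 * ?f), wd (Suc (2 * ?f))) = (k, j)"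
        using wd_pair[of e] wd_pair[of ?f] e by (auto simp: nth_append M_def)
      ultimately show "p \<in> ?L"
        using p(1) e dst_eq_src[of e ?f] by (intro CollectI exI[of _ e] exI[of _ ?f]) simp
    qed
  qed
  also have "\<dots> = one_entries n (bool_matrix_mult n A B)"
    unfolding as bs by (auto simp: one_entries_def bool_matrix_mult_def)
  finally show ?thesis .
qed

lemma length_concat_take_adj:
  "i \<le> 2 * M \<Longrightarrow> length (concat (take i (adj z))) = cnt (\<lambda>e. src e < i) M"
  using length_count_sort[of src M i]
  by (simp add: adj_def take_map count_sort_def length_concat comp_def)

lemma concat_adj: "concat (adj z) = map (\<lambda>e. (z, dst e)) (count_sort src M (2 * M))"
  by (simp add: adj_def count_sort_def map_concat comp_def)

lemma length_count_sort_src: "length (count_sort src M (2 * M)) = M"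
  using src_less by (simp add: length_count_sort cnt_all)

text \<open>The last four words are the length of the query string, the symbol 1 of
  \<open>Cat\<close>, and the letter twice.\<close>

lemma eval_input_eq:
  "eval_input num (adj z) (query z) =
     [2 * M, M] @ map (\<lambda>i. cnt (\<lambda>e. src e < i) M) [0..<Suc (2 * M)] @
     flatten_pairs (map (\<lambda>e. (num z, dst e)) (count_sort src M (2 * M))) @
     [3, 1, 4 + num z, 4 + num z]"
proof -
  have "length (adj z) = 2 * M" by (simp add: adj_def)
  moreover have "length (concat (adj z)) = M" by (simp add: concat_adj length_count_sort_src)
  moreover have "map (\<lambda>i. length (concat (take i (adj z)))) [0..<Suc (2 * M)] =
      map (\<lambda>i. cnt (\<lambda>e. src e < i) M) [0..<Suc (2 * M)]"
    by (intro map_cong refl length_concat_take_adj) auto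
  moreover have "map (\<lambda>(a, j). (num a, j)) (concat (adj z)) =
      map (\<lambda>e. (num z, dst e)) (count_sort src M (2 * M))"
    by (simp add: concat_adj comp_def)
  ultimately show ?thesis
    by (simp add: eval_input_def query_def del: upt_Suc)
qed

lemma length_eval_input: "length (eval_input num (adj z) (query z)) = 4 * M + 7"
  by (simp add: eval_input_eq length_count_sort_src)

lemma eval_input_bound:
  "x \<in> set (eval_input num (adj z) (query z)) \<Longrightarrow> x \<le> 2 * M + num z + 4"
proof -
  assume "x \<in> set (eval_input num (adj z) (query z))"
  then consider "x = 2 * M" | Q where "x = cnt Q M" | "x = M"
    | e where "e \<in> set (count_sort src M (2 * M))" "x = num z \<or> x = dst e"
    | "x \<le> 3" | "x = 4 + num z"
    unfolding eval_input_eq by (fastforce simp: set_flatten simp del: upt_Suc)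
  then show ?thesis
  proof cases
    case (2 Q)
    then show ?thesis using cnt_le[of Q M] by simp
  next
    case (4 e)
    then show ?thesis using set_count_sort[of src M "2 * M"] dst_less[of e] by auto
  qed auto
qed

text \<open>The arc block is specified through \<open>rank\<close>, the way the program fills it; as
  \<open>rank\<close> is onto, this determines every cell of the block.\<close>

lemma eval_input_memory:
  assumes "g 0 = 2 * M" "g 1 = M"
    and off: "\<And>t. t \<le> 2 * M \<Longrightarrow> g (2 + t) = cnt (\<lambda>e. src e < t) M"
    and arcs: "\<And>e. e < M \<Longrightarrow> g (3 + 2 * M + 2 * rank src M e) = num z"
      "\<And>e. e < M \<Longrightarrow> g (4 + 2 * M + 2 * rank src M e) = dst e"
    and query: "g (3 + 4 * M) = 3" "g (4 + 4 * M) = 1" "g (5 + 4 * M) = 4 + num z"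
      "g (6 + 4 * M) = 4 + num z"
    and rest: "\<And>a. 7 + 4 * M \<le> a \<Longrightarrow> g a = 0"
  shows "g = mem (initial (eval_input num (adj z) (query z)))"
proof -
  let ?X = "eval_input num (adj z) (query z)"
  let ?O = "map (\<lambda>i. cnt (\<lambda>e. src e < i) M) [0..<Suc (2 * M)]"
  let ?F = "flatten_pairs (map (\<lambda>e. (num z, dst e)) (count_sort src M (2 * M)))"
  have X: "?X = [2 * M, M] @ ?O @ ?F @ [3, 1, 4 + num z, 4 + num z]" by (rule eval_input_eq)
  have lO: "length ?O = Suc (2 * M)" by simp
  have lF: "length ?F = 2 * M" by (simp add: length_count_sort_src)
  have last: "?X ! a = [3, 1, 4 + num z, 4 + num z] ! i" if "a = 3 + 4 * M + i" for a i
    using nth_append_length_plus[of "[2 * M, M] @ ?O @ ?F" "[3, 1, 4 + num z, 4 + num z]" i] lO lF that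
    by (simp add: X del: upt_Suc)
  have "g a = ?X ! a" if a: "a < 7 + 4 * M" for a
  proof -
    consider "a = 0" | "a = 1" | t where "t \<le> 2 * M" "a = 2 + t"
      | p where "p < M" "a = 3 + 2 * M + 2 * p" | p where "p < M" "a = 4 + 2 * M + 2 * p"
      | "a = 3 + 4 * M" | "a = 4 + 4 * M" | "a = 5 + 4 * M" | "a = 6 + 4 * M"
    proof -
      consider "a < 2" | "2 \<le> a" "a < 3 + 2 * M" | "3 + 2 * M \<le> a" "a < 3 + 4 * M"
        | "3 + 4 * M \<le> a" by linarith
      then show ?thesis
      proof cases
        case 1 then show ?thesis using that(1,2) by linarith
      next
        case 2 then show ?thesis using that(3)[of "a - 2"] by linarith
      next
        case 3
        \<comment> \<open>Inside the arc block, the parity of the offset separates letters from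
          targets.\<close>
        define b where "b = a - (3 + 2 * M)"
        have "a = 3 + 2 * M + (2 * (b div 2) + b mod 2)" "b div 2 < M"
          using 3 by (auto simp: b_def)
        then show ?thesis using that(4,5)[of "b div 2"] by linarith
      next
        case 4 then show ?thesis using that(6-9) a by linarith
      qed
    qed
    then show ?thesis
    proof cases
      case (3 t)
      then have "?X ! a = (?O @ (?F @ [3, 1, 4 + num z, 4 + num z])) ! t" by (simp add: X del: upt_Suc)
      also have "\<dots> = cnt (\<lambda>e. src e < t) M" using 3 lO by (simp add: nth_append del: upt_Suc)
      finally show ?thesis using 3 off by simp
    next
      case (4 p)
      obtain e where e: "e < M" "rank src M e = p"
        using rank_bij[of M src "2 * M"] src_less 4(1) unfolding bij_betw_def
        by (metis (no_types, lifting) imageE lessThan_iff)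
      have "?X ! a = (?O @ (?F @ [3, 1, 4 + num z, 4 + num z])) ! (length ?O + 2 * p)"
        using 4 by (simp add: X del: upt_Suc)
      also have "\<dots> = (?F @ [3, 1, 4 + num z, 4 + num z]) ! (2 * p)" by (rule nth_append_length_plus)
      also have "\<dots> = num z"
        using 4(1) by (simp add: nth_append nth_flatten length_count_sort_src)
      finally show ?thesis using 4 arcs(1)[OF e(1)] e(2) by simp
    next
      case (5 p)
      obtain e where e: "e < M" "rank src M e = p"
        using rank_bij[of M src "2 * M"] src_less 5(1) unfolding bij_betw_def
        by (metis (no_types, lifting) imageE lessThan_iff)
      have "?X ! a = (?O @ (?F @ [3, 1, 4 + num z, 4 + num z])) ! (length ?O + Suc (2 * p))"
        using 5 by (simp add: X del: upt_Suc)
      also have "\<dots> = (?F @ [3, 1, 4 + num z, 4 + num z]) ! Suc (2 * p)"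
        by (rule nth_append_length_plus)
      also have "\<dots> = dst e"
        using 5(1) e nth_count_sort(2)[of e M src "2 * M"] src_less
        by (simp add: nth_append nth_flatten length_count_sort_src)
      finally show ?thesis using 5 arcs(2)[OF e(1)] e(2) by simp
    qed (use assms(1,2) query last[of a 0] last[of a 1] last[of a 2] last[of a 3] in \<open>simp_all add: X\<close>)
  qed
  then show ?thesis
    using rest by (auto simp: fun_eq_iff initial_def length_eval_input not_less)
qed

end

lemma wp_append: "wp b (is @ js) Q r m = wp b is (wp b js Q) r m"
  by (induction b "is" "wp b js Q" r m rule: wp.induct) auto

lemma wp_mono: "\<lbrakk>wp b is Q r m; \<And>r m. Q r m \<Longrightarrow> Q' r m\<rbrakk> \<Longrightarrow> wp b is Q' r m"
  by (induction b "is" Q r m rule: wp.induct) auto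

lemma triple_ex:
  "(\<And>y. triple b (Q y) F T (Q' y)) \<Longrightarrow> triple b (\<lambda>r m. \<exists>y. Q y r m) F T (\<lambda>r m. \<exists>y. Q' y r m)"
  unfolding triple_def by meson

section \<open>The reduction as a program\<close>

text \<open>
  Register 6 is the loop counter. \<open>key_addr\<close> turns the input position in register 15 into the
  address in register 12 of its representative. The offset array is built in place: it first counts
  the arcs of each source, then \<open>offset_code\<close>, running from the last node to the first, replaces
  each count by the end of the bucket, and \<open>arc_code\<close> moves each end down to the start while
  it fills the bucket.
\<close>

definition key_addr :: "instr list" where
  "key_addr =
     [Bin Add 13 15 8, Load 12 13, Bin Sub 13 2 15, Bin Sub 13 5 13, Bin Mod 14 15 7,
      Bin Add 13 14 13, Bin Mul 13 3 13, Bin Add 12 12 13, Bin Add 12 4 12]"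

text \<open>Registers 0, 5 and 7, with contents 0, 1 and 2, double as addresses of the three header
  words of the input. As register 0 stays 0 until the simulation, adding it copies a
  register.\<close>

definition setup_code :: "nat \<Rightarrow> instr list" where
  "setup_code l =
     [Const 5 1, Const 7 2, Const 8 3, Const 10 l, Load 3 0, Load 2 5, Load 9 7, Bin Add 9 2 9,
      Bin Add 2 2 2, Bin Add 6 9 9, Bin Add 4 6 8, Bin Mul 1 3 8, Bin Add 1 4 1]"

text \<open>The counter runs downwards, so the final write into the cell of a key comes from its
  smallest position, in accordance with \<open>rep\<close>.\<close>

definition rep_code :: "instr list" where
  "rep_code = [Bin Sub 6 6 5, Bin Add 15 6 0] @ key_addr @ [Store 12 6]"

definition count_code :: "instr list" where
  "count_code = [Bin Sub 6 6 5, Bin Mul 15 7 6] @ key_addr @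
     [Load 13 12, Bin Add 13 13 7, Bin Add 13 13 1, Load 14 13, Bin Add 14 14 5, Store 13 14]"

definition offset_code :: "instr list" where
  "offset_code =
     [Bin Sub 6 6 5, Bin Add 13 6 7, Bin Add 13 13 1, Load 14 13, Store 13 11, Bin Sub 11 11 14]"

definition arc_code :: "instr list" where
  "arc_code = [Bin Sub 6 6 5, Bin Mul 15 7 6] @ key_addr @ [Load 16 12, Bin Add 15 15 5] @ key_addr @
     [Load 17 12, Bin Add 13 16 7, Bin Add 13 13 1, Load 14 13, Bin Sub 14 14 5, Store 13 14,
      Bin Mul 14 14 7, Bin Add 14 14 4, Bin Add 14 14 1, Store 14 10, Bin Add 14 14 5, Store 14 17]"

definition header_code :: "nat \<Rightarrow> instr list" where
  "header_code l =
     [Bin Add 6 9 9, Store 1 6, Bin Add 13 1 5, Store 13 9, Bin Add 13 1 8, Bin Add 13 13 6,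
      Bin Add 13 13 6, Store 13 8, Bin Add 13 13 5, Store 13 5, Const 12 (4 + l), Bin Add 13 13 5,
      Store 13 12, Bin Add 13 13 5, Store 13 12]"

text \<open>A node is a position in the input, so its index is simply input word
  \<open>3 + node\<close>. This word lies below \<open>V\<close>, out of reach of the simulated
  program. The output block is translated in place.\<close>

definition output_code :: "instr list" where
  "output_code =
     [Bin Sub 6 6 5, Bin Add 12 6 16, Bin Add 12 12 5, Load 13 12, Bin Add 13 13 8, Load 13 13,
      Store 12 13]"

text \<open>The shift by 32 clears all registers used by the host. Register 0 of \<open>P\<close>
  becomes register 32, from which the address of the output block is recovered; the host's register
  0 holds scratch data by then and is reset.\<close>

definition reduction_code :: "nat \<Rightarrow> instr list \<Rightarrow> nat \<Rightarrow> instr list" where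
  "reduction_code l P =
     straight (setup_code l) ;; loop 6 (straight rep_code) ;;
     straight [Bin Add 6 9 0] ;; loop 6 (straight count_code) ;;
     straight [Bin Add 6 9 9, Bin Add 6 6 5, Bin Add 11 9 0] ;; loop 6 (straight offset_code) ;;
     straight [Bin Add 6 9 0] ;; loop 6 (straight arc_code) ;;
     straight (header_code l) ;; relocate 32 P ;;
     straight [Bin Add 16 32 1, Load 6 16, Bin Mul 6 6 7] ;; loop 6 (straight output_code) ;;
     straight [Const 0 0, Bin Add 0 0 16]"

locale sbmm_run = sbmm_lists +
  fixes l b :: nat
  assumes b: "10 * (n + length as + length bs + l + 10) < b"
begin

text \<open>The input occupies the cells below \<open>R\<close>, the renaming table lies between
  \<open>R\<close> and \<open>V\<close>, and the Eval input is built from \<open>V\<close>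
  on.\<close>

definition R :: nat where "R = 3 + 2 * M"

definition V :: nat where "V = R + 3 * n"

lemma b_V: "V + 6 * M + l + 50 < b"
  using b by (simp add: V_def R_def M_def)

text \<open>The registers from 32 on are kept 0 because they become the initial registers of the
  simulated program.\<close>

definition common :: "(nat \<Rightarrow> nat) \<Rightarrow> (nat \<Rightarrow> nat) \<Rightarrow> bool" where
  "common r m \<longleftrightarrow> r 0 = 0 \<and> r 1 = V \<and> r 2 = 2 * length as \<and> r 3 = n \<and> r 4 = R \<and> r 5 = 1 \<and>
     r 7 = 2 \<and> r 8 = 3 \<and> r 9 = M \<and> r 10 = l \<and> (\<forall>x\<ge>32. r x = 0) \<and>
     (\<forall>t<2 * M. m (3 + t) = wd t)"

lemma wp_key_addr:
  assumes "common r m" "r 15 = t" "t < 2 * M"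
    and "wp b is Q (r(14 := t mod 2, 13 := n * cls t, 12 := R + key t)) m"
  shows "wp b (key_addr @ is) Q r m"
proof -
  have c: "n * cls t \<le> 2 * n" using mult_le_mono2[OF cls_le[of t], of n] by linarith
  have k: "wd t + n * cls t = key t" by (simp add: key_def)
  have cl: "t mod 2 + (Suc 0 - (2 * length as - t)) = cls t" by (simp add: cls_def)
  have lt: "key t < 3 * n" "wd t < n" "cls t \<le> 2"
    using key_less wd_less cls_le assms(3) by auto
  have f: "r 15 = t" "r 8 = 3" "r 2 = 2 * length as" "r 5 = 1" "r 7 = 2" "r 3 = n" "r 4 = R"
    "m (t + 3) = wd t"
    using assms(1-3) by (auto simp: common_def add.commute)
  have d: "t mod 2 < 2" by simp
  have "n * cls t < b" by (rule le_less_trans[OF c]) (use b in simp)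
  moreover have "t + 3 < b" "2 * length as - t < b" "1 - (2 * length as - t) < b" "t mod 2 < b"
    "cls t < b" "key t < b" "R + key t < b"
    using b_V lt c d assms(3) b by (auto simp: V_def R_def M_def)
  ultimately have "wp b key_addr (\<lambda>r' m'. r' = r(14 := t mod 2, 13 := n * cls t, 12 := R + key t) \<and> m' = m) r m"
    unfolding key_addr_def by (simp add: f cl k fun_eq_iff)
  then show ?thesis
    unfolding wp_append by (rule wp_mono) (use assms(4) in auto)
qed

section \<open>Invariants of the loops that build the Eval input\<close>

definition reps :: "(nat \<Rightarrow> nat) \<Rightarrow> bool" where
  "reps m \<longleftrightarrow> (\<forall>t<2 * M. m (R + key t) = rep t)"

lemma common_upd [simp]: "V \<le> x \<Longrightarrow> common r (m(x := v)) = common r m"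
  by (auto simp: common_def V_def R_def)

lemma common_reg [simp]:
  "x = 6 \<or> 10 < x \<and> x < 32 \<Longrightarrow> common (r(x := v)) m = common r m"
  by (auto simp: common_def)

lemma reps_upd [simp]: "V \<le> x \<Longrightarrow> reps (m(x := v)) = reps m"
  using key_less by (fastforce simp: reps_def V_def)

definition I1 :: "nat \<Rightarrow> (nat \<Rightarrow> nat) \<Rightarrow> (nat \<Rightarrow> nat) \<Rightarrow> bool" where
  "I1 j r m \<longleftrightarrow> common r m \<and>
     (\<forall>t. j \<le> t \<and> t < 2 * M \<longrightarrow> m (R + key t) = (LEAST t'. j \<le> t' \<and> key t' = key t)) \<and>
     (\<forall>a. m (V + a) = 0)"

text \<open>The arcs from \<open>j\<close> on have been counted; the sum form avoids truncated
  subtraction.\<close>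

definition I2 :: "nat \<Rightarrow> (nat \<Rightarrow> nat) \<Rightarrow> (nat \<Rightarrow> nat) \<Rightarrow> bool" where
  "I2 j r m \<longleftrightarrow> common r m \<and> reps m \<and>
     (\<forall>t\<le>2 * M. m (V + (2 + t)) + cnt (\<lambda>e. src e = t) j = cnt (\<lambda>e. src e = t) M) \<and>
     (\<forall>a. 2 * M + 3 \<le> a \<longrightarrow> m (V + a) = 0)"

text \<open>Register 11 is the end of bucket \<open>j - 1\<close>, the next one to be stored;
  subtracting the count of that bucket gives the end before it. Cell \<open>2 * M\<close> belongs to
  no node and becomes the closing offset \<open>M\<close>.\<close>

definition I3 :: "nat \<Rightarrow> (nat \<Rightarrow> nat) \<Rightarrow> (nat \<Rightarrow> nat) \<Rightarrow> bool" where
  "I3 j r m \<longleftrightarrow> common r m \<and> reps m \<and> r 11 = cnt (\<lambda>e. src e < j) M \<and>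
     (\<forall>t\<le>2 * M. m (V + (2 + t)) =
        (if j \<le> t then cnt (\<lambda>e. src e < Suc t) M else cnt (\<lambda>e. src e = t) M)) \<and>
     (\<forall>a. 2 * M + 3 \<le> a \<longrightarrow> m (V + a) = 0)"

text \<open>An offset exceeds the start of its bucket by the number of arcs still to be placed
  there. With \<open>j = M\<close> this is the bucket end left by \<open>I3 0\<close>; with
  \<open>j = 0\<close> it is the start that the input format demands.\<close>

definition I4 :: "nat \<Rightarrow> (nat \<Rightarrow> nat) \<Rightarrow> (nat \<Rightarrow> nat) \<Rightarrow> bool" where
  "I4 j r m \<longleftrightarrow> common r m \<and> reps m \<and>
     (\<forall>t\<le>2 * M. m (V + (2 + t)) = cnt (\<lambda>e. src e < t) M + cnt (\<lambda>e. src e = t) j) \<and>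
     (\<forall>e. j \<le> e \<and> e < M \<longrightarrow> m (V + (3 + 2 * M + 2 * rank src M e)) = l \<and>
        m (V + (4 + 2 * M + 2 * rank src M e)) = dst e) \<and>
     (\<forall>a. 4 * M + 3 \<le> a \<longrightarrow> m (V + a) = 0)"

lemma setup_triple:
  "triple b (\<lambda>r m. r = (\<lambda>_. 0) \<and> m = mem (initial (sbmm_input n as bs))) (straight (setup_code l))
     (length (setup_code l)) (\<lambda>r m. r 6 = 2 * M \<and> I1 (2 * M) r m)"
proof (rule triple_straight, clarify)
  let ?X = "sbmm_input n as bs"
  let ?m = "mem (initial ?X)"
  have X: "?X = [n, length as, length bs] @ flatten_pairs (as @ bs)"
    by (simp add: sbmm_input_def flatten_append)
  have m: "?m 0 = n" "?m (Suc 0) = length as" "?m 2 = length bs"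
    by (simp_all add: initial_def X)
  have w: "?m (3 + t) = wd t" if "t < 2 * M" for t
    using that unfolding X initial_def by (simp add: wd_def M_def flatten_append)
  have "length ?X \<le> V" by (simp add: X V_def R_def M_def)
  then have v: "?m (V + a) = 0" for a by (simp add: initial_def)
  show "wp b (setup_code l) (\<lambda>r m. r 6 = 2 * M \<and> I1 (2 * M) r m) (\<lambda>_. 0) ?m"
    unfolding setup_code_def using b
    by (simp add: m I1_def common_def w v) (auto simp: V_def R_def M_def)
qed

lemma rep_loop:
  assumes j: "j < 2 * M"
  shows "triple b (\<lambda>r m. r 6 = Suc j \<and> I1 (Suc j) r m) (straight rep_code) (length rep_code)
    (\<lambda>r m. r 6 = j \<and> I1 j r m)"
proof (rule triple_straight, clarify)
  fix r m assume r6: "r 6 = Suc j" and I: "I1 (Suc j) r m"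
  have k: "key j < 3 * n" using key_less[OF j] .
  have jb: "j < b" using j b_V by linarith
  let ?r = "r(6 := j, 15 := j, 14 := j mod 2, 13 := n * cls j, 12 := R + key j)"
  have c: "common (r(6 := j, 15 := j)) m" using I by (auto simp: I1_def common_def)
  have "I1 j ?r (m(R + key j := j))"
    unfolding I1_def
  proof (intro conjI allI impI)
    show "common ?r (m(R + key j := j))"
      using I k by (auto simp: I1_def common_def R_def)
    show "(m(R + key j := j)) (V + a) = 0" for a
      using I k by (auto simp: I1_def V_def)
    fix t assume t: "j \<le> t \<and> t < 2 * M"
    show "(m(R + key j := j)) (R + key t) = (LEAST t'. j \<le> t' \<and> key t' = key t)"
    proof (cases "key t = key j")
      case True
      then show ?thesis by (auto intro!: Least_equality[symmetric])
    next
      case False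
      then have "j \<noteq> t" by auto
      then have "m (R + key t) = (LEAST t'. Suc j \<le> t' \<and> key t' = key t)"
        using I t by (simp add: I1_def)
      moreover have "(Suc j \<le> t' \<and> key t' = key t) = (j \<le> t' \<and> key t' = key t)" for t'
        using False by (metis Suc_le_eq le_less)
      ultimately show ?thesis using False by simp
    qed
  qed
  then show "wp b rep_code (\<lambda>r m. r 6 = j \<and> I1 j r m) r m"
    unfolding rep_code_def using I r6 jb
    by (auto simp: I1_def common_def intro!: wp_key_addr[OF c _ j])
qed

lemma count_loop:
  assumes j: "j < M"
  shows "triple b (\<lambda>r m. r 6 = Suc j \<and> I2 (Suc j) r m) (straight count_code) (length count_code)
    (\<lambda>r m. r 6 = j \<and> I2 j r m)"
proof (rule triple_straight, clarify)
  fix r m assume r6: "r 6 = Suc j" and I: "I2 (Suc j) r m"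
  have j2: "2 * j < 2 * M" using j by simp
  have s: "m (R + key (2 * j)) = src j" using I j by (simp add: I2_def reps_def src_def)
  have sl: "src j < 2 * M" using src_less[OF j] .
  let ?v = "m (V + (2 + src j))"
  have v: "?v + cnt (\<lambda>e. src e = src j) j + 1 = cnt (\<lambda>e. src e = src j) M"
  proof -
    have "?v + cnt (\<lambda>e. src e = src j) (Suc j) = cnt (\<lambda>e. src e = src j) M"
      using I sl unfolding I2_def by (meson less_imp_le)
    then show ?thesis by simp
  qed
  have v': "?v < M" using v cnt_le[of "\<lambda>e. src e = src j" M] by linarith
  have c: "common (r(6 := j, 15 := 2 * j)) m" using I by (auto simp: I2_def common_def)
  have I': "I2 j r' (m(V + (2 + src j) := Suc ?v))"
    if "common r' m" for r'
    using that I sl v by (auto simp: I2_def)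
  have *: "r 5 = 1" "r 7 = 2" "r 1 = V" using I by (auto simp: I2_def common_def)
  have "wp b ([Load 13 12, Bin Add 13 13 7, Bin Add 13 13 1, Load 14 13, Bin Add 14 14 5, Store 13 14])
    (\<lambda>r m. r 6 = j \<and> I2 j r m)
    (r(6 := j, 15 := 2 * j, 14 := 2 * j mod 2, 13 := n * cls (2 * j), 12 := R + key (2 * j))) m"
  proof -
    have cm: "common r m" using I by (simp add: I2_def)
    have "wp b ([Load 13 12, Bin Add 13 13 7, Bin Add 13 13 1, Load 14 13, Bin Add 14 14 5, Store 13 14])
      (\<lambda>r' m'. r' 6 = j \<and> common r' m \<and> m' = m(V + (2 + src j) := Suc ?v))
      (r(6 := j, 15 := 2 * j, 14 := 2 * j mod 2, 13 := n * cls (2 * j), 12 := R + key (2 * j))) m"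
      using * s sl b_V v' cm by (simp add: add.commute[of "src j"])
    then show ?thesis by (rule wp_mono) (use I' in auto)
  qed
  from wp_key_addr[OF c _ j2 this]
  show "wp b count_code (\<lambda>r m. r 6 = j \<and> I2 j r m) r m"
    unfolding count_code_def using *(1,2) r6 j b_V by simp
qed

lemma offset_loop:
  assumes j: "j < Suc (2 * M)"
  shows "triple b (\<lambda>r m. r 6 = Suc j \<and> I3 (Suc j) r m) (straight offset_code) (length offset_code)
    (\<lambda>r m. r 6 = j \<and> I3 j r m)"
proof (rule triple_straight, clarify)
  fix r m assume r6: "r 6 = Suc j" and I: "I3 (Suc j) r m"
  have *: "r 5 = 1" "r 7 = 2" "r 1 = V" "r 11 = cnt (\<lambda>e. src e < Suc j) M" 
    using I by (auto simp: I3_def common_def)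
  have v: "m (V + (2 + j)) = cnt (\<lambda>e. src e = j) M" using I j by (simp add: I3_def)
  have le: "cnt (\<lambda>e. src e < Suc j) M \<le> M" using cnt_le .
  have cm: "common r m" using I by (simp add: I3_def)
  have I': "I3 j r' (m(V + (2 + j) := cnt (\<lambda>e. src e < Suc j) M))"
    if "common r' m" "r' 11 = cnt (\<lambda>e. src e < j) M" for r'
    using that I j by (auto simp: I3_def)
  have "wp b offset_code (\<lambda>r' m'. r' 6 = j \<and> common r' m \<and> r' 11 = cnt (\<lambda>e. src e < j) M \<and>
      m' = m(V + (2 + j) := cnt (\<lambda>e. src e < Suc j) M)) r m"
    unfolding offset_code_def using * r6 j b_V v le cm
    by (simp add: cnt_less_Suc add.commute[of j])
  then show "wp b offset_code (\<lambda>r m. r 6 = j \<and> I3 j r m) r m"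
    by (rule wp_mono) (use I' in auto)
qed

lemma rank_less: "e < M \<Longrightarrow> rank src M e < M"
  using rank_bij[of M src "2 * M"] src_less by (auto simp: bij_betw_def)

lemma rank_eq: "\<lbrakk>e < M; e' < M\<rbrakk> \<Longrightarrow> rank src M e = rank src M e' \<longleftrightarrow> e = e'"
  using rank_bij[of M src "2 * M"] src_less by (auto simp: bij_betw_def inj_on_def)

lemma arc_loop:
  assumes j: "j < M"
  shows "triple b (\<lambda>r m. r 6 = Suc j \<and> I4 (Suc j) r m) (straight arc_code) (length arc_code)
    (\<lambda>r m. r 6 = j \<and> I4 j r m)"
proof (rule triple_straight, clarify)
  fix r m assume r6: "r 6 = Suc j" and I: "I4 (Suc j) r m"
  have j2: "2 * j < 2 * M" "Suc (2 * j) < 2 * M" using j by auto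
  have s: "m (R + key (2 * j)) = src j" "m (R + key (Suc (2 * j))) = dst j"
    using I j j2 by (auto simp: I4_def reps_def src_def dst_def)
  have sl: "src j < 2 * M" using src_less[OF j] .
  let ?p = "rank src M j"
  have p: "?p < M" using rank_less[OF j] .
  \<comment> \<open>Arc \<open>j\<close> is itself still unplaced and all others left in its bucket
    precede it, so the decremented cell is exactly its rank.\<close>
  have v: "m (V + (2 + src j)) = Suc ?p"
    using I sl by (simp add: I4_def rank_def)
  let ?m = "m(V + (2 + src j) := ?p, V + (3 + 2 * M + 2 * ?p) := l, V + (4 + 2 * M + 2 * ?p) := dst j)"
  have I': "I4 j r' ?m" if c: "common r' m" for r'
    unfolding I4_def
  proof (intro conjI allI impI)
    show "common r' ?m" using c by simp
    show "reps ?m" using I by (simp add: I4_def)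
    show "?m (V + (2 + t)) = cnt (\<lambda>e. src e < t) M + cnt (\<lambda>e. src e = t) j" if "t \<le> 2 * M" for t
      using I that by (auto simp: I4_def rank_def)
    show "?m (V + a) = 0" if "4 * M + 3 \<le> a" for a
      using I that sl p by (auto simp: I4_def)
    fix e assume e: "j \<le> e \<and> e < M"
    have d: "V + (3 + 2 * M + 2 * x) \<noteq> V + (2 + src j)" "V + (4 + 2 * M + 2 * x) \<noteq> V + (2 + src j)"
      "V + (3 + 2 * M + 2 * x) \<noteq> V + (4 + 2 * M + 2 * y)"
      "V + (4 + 2 * M + 2 * x) \<noteq> V + (3 + 2 * M + 2 * y)" for x y
      using sl by presburger+
    have "m (V + (3 + 2 * M + 2 * rank src M e)) = l \<and> m (V + (4 + 2 * M + 2 * rank src M e)) = dst e"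
      if "e \<noteq> j"
      using I e that by (auto simp: I4_def)
    then show "?m (V + (3 + 2 * M + 2 * rank src M e)) = l"
      and "?m (V + (4 + 2 * M + 2 * rank src M e)) = dst e"
      using d rank_eq[of e j] e j by (cases "e = j"; simp)+
  qed
  have c1: "common (r(6 := j, 15 := 2 * j)) m" using I by (auto simp: I4_def common_def)
  let ?r = "r(6 := j, 15 := 2 * j, 14 := 2 * j mod 2, 13 := n * cls (2 * j), 12 := R + key (2 * j),
    16 := src j, 15 := Suc (2 * j))"
  have c2: "common ?r m" using I by (auto simp: I4_def common_def)
  let ?t = "Suc (2 * j)"
  have cm: "common r m" using I by (simp add: I4_def)
  let ?r' = "?r(14 := ?t mod 2, 13 := n * cls ?t, 12 := R + key ?t)"
  have *: "r 5 = 1" "r 7 = 2" "r 1 = V" "r 4 = R" "r 10 = l" using I by (auto simp: I4_def common_def)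
  have e: "src j + 2 + V = V + (2 + src j)" "?p * 2 + R + V = V + (3 + 2 * M + 2 * ?p)"
    "Suc (V + (3 + 2 * M + 2 * ?p)) = V + (4 + 2 * M + 2 * ?p)"
    by (auto simp: R_def)
  have "wp b [Load 17 12, Bin Add 13 16 7, Bin Add 13 13 1, Load 14 13, Bin Sub 14 14 5, Store 13 14,
      Bin Mul 14 14 7, Bin Add 14 14 4, Bin Add 14 14 1, Store 14 10, Bin Add 14 14 5, Store 14 17]
      (\<lambda>r' m'. r' 6 = j \<and> common r' m \<and> m' = ?m) ?r' m"
    using * s sl p v b_V e cm by simp (simp add: R_def ac_simps)
  then have w: "wp b [Load 17 12, Bin Add 13 16 7, Bin Add 13 13 1, Load 14 13, Bin Sub 14 14 5, Store 13 14,
      Bin Mul 14 14 7, Bin Add 14 14 4, Bin Add 14 14 1, Store 14 10, Bin Add 14 14 5, Store 14 17]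
      (\<lambda>r m. r 6 = j \<and> I4 j r m) ?r' m"
    by (rule wp_mono) (use I' in auto)
  have "wp b ([Load 16 12, Bin Add 15 15 5] @ key_addr @
     [Load 17 12, Bin Add 13 16 7, Bin Add 13 13 1, Load 14 13, Bin Sub 14 14 5, Store 13 14,
      Bin Mul 14 14 7, Bin Add 14 14 4, Bin Add 14 14 1, Store 14 10, Bin Add 14 14 5, Store 14 17])
    (\<lambda>r m. r 6 = j \<and> I4 j r m)
    (r(6 := j, 15 := 2 * j, 14 := 2 * j mod 2, 13 := n * cls (2 * j), 12 := R + key (2 * j))) m"
    using * s(1) j2 b_V wp_key_addr[OF c2 _ j2(2) w] by (simp add: fun_upd_twist)
  from wp_key_addr[OF c1 _ j2(1) this]
  show "wp b arc_code (\<lambda>r m. r 6 = j \<and> I4 j r m) r m"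
    unfolding arc_code_def using *(1,2) r6 j b_V by simp
qed

lemma count_start:
  "triple b (I1 0) (straight [Bin Add 6 9 0]) (length [Bin Add 6 9 0]) (\<lambda>r m. r 6 = M \<and> I2 M r m)"
proof (rule triple_straight)
  fix r m assume I: "I1 0 r m"
  then have *: "r 9 = M" "r 0 = 0" by (auto simp: I1_def common_def)
  have v: "m (V + (2 + t)) = 0" for t using I unfolding I1_def by blast
  show "wp b [Bin Add 6 9 0] (\<lambda>r m. r 6 = M \<and> I2 M r m) r m"
    using * I b_V v by (simp add: I1_def I2_def reps_def rep_def)
qed

lemma offset_start:
  "triple b (I2 0) (straight [Bin Add 6 9 9, Bin Add 6 6 5, Bin Add 11 9 0])
     (length [Bin Add 6 9 9, Bin Add 6 6 5, Bin Add 11 9 0])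
     (\<lambda>r m. r 6 = Suc (2 * M) \<and> I3 (Suc (2 * M)) r m)"
proof (rule triple_straight)
  fix r m assume I: "I2 0 r m"
  then have "r 9 = M" "r 0 = 0" "r 5 = 1" by (auto simp: I2_def common_def)
  moreover have "cnt (\<lambda>e. src e < Suc (2 * M)) M = M"
    using src_less by (intro cnt_all) (auto simp: less_Suc_eq)
  ultimately show "wp b [Bin Add 6 9 9, Bin Add 6 6 5, Bin Add 11 9 0]
      (\<lambda>r m. r 6 = Suc (2 * M) \<and> I3 (Suc (2 * M)) r m) r m"
    using I b_V by (simp add: I2_def I3_def)
qed

lemma arc_start:
  "triple b (I3 0) (straight [Bin Add 6 9 0]) (length [Bin Add 6 9 0]) (\<lambda>r m. r 6 = M \<and> I4 M r m)"
proof (rule triple_straight)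
  fix r m assume I: "I3 0 r m"
  then have "r 9 = M" "r 0 = 0" by (auto simp: I3_def common_def)
  then show "wp b [Bin Add 6 9 0] (\<lambda>r m. r 6 = M \<and> I4 M r m) r m"
    using I b_V by (simp add: I3_def I4_def cnt_less_Suc)
qed

section \<open>Simulating the Eval program and translating its output\<close>

definition simulating ::
    "config \<Rightarrow> (nat \<Rightarrow> nat) \<times> (nat \<Rightarrow> nat) \<Rightarrow> (nat \<Rightarrow> nat) \<Rightarrow> (nat \<Rightarrow> nat) \<Rightarrow> bool" where
  "simulating s y r m \<longleftrightarrow> common (fst y) (snd y) \<and> simulates 32 V (fst y) (snd y) s r m"

lemma header:
  assumes l: "l = num z"
  shows "triple b (I4 0) (straight (header_code l)) (length (header_code l))
    (\<lambda>r m. \<exists>y. simulating (initial (eval_input num (adj z) (query z))) y r m)"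
proof (rule triple_straight)
  let ?s = "initial (eval_input num (adj z) (query z))"
  fix r m assume I: "I4 0 r m"
  have cm: "common r m" using I by (simp add: I4_def)
  have *: "r 9 = M" "r 5 = 1" "r 1 = V" "r 8 = 3" using I by (auto simp: I4_def common_def)
  let ?m = "m(V := M + M, V + 1 := M, V + (3 + 4 * M) := 3, V + (4 + 4 * M) := 1,
    V + (5 + 4 * M) := 4 + l, V + (6 + 4 * M) := 4 + l)"
  have "(\<lambda>a. ?m (V + a)) = mem ?s"
  proof (rule eval_input_memory)
    fix e assume e: "e < M"
    have "rank src M e < M" using rank_less[OF e] .
    moreover have "m (V + (3 + 2 * M + 2 * rank src M e)) = l"
      "m (V + (4 + 2 * M + 2 * rank src M e)) = dst e"
      using I e unfolding I4_def by blast+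
    ultimately show "?m (V + (3 + 2 * M + 2 * rank src M e)) = num z"
      "?m (V + (4 + 2 * M + 2 * rank src M e)) = dst e"
      using l by simp_all
  next
    show "?m (V + (2 + t)) = cnt (\<lambda>e. src e < t) M" if "t \<le> 2 * M" for t
    proof -
      have "m (V + (2 + t)) = cnt (\<lambda>e. src e < t) M + cnt (\<lambda>e. src e = t) 0"
        using I that unfolding I4_def by blast
      then show ?thesis using that by simp
    qed
    show "?m (V + a) = 0" if "7 + 4 * M \<le> a" for a
    proof -
      have "m (V + a) = 0" using I that unfolding I4_def by simp
      then show ?thesis using that by simp
    qed
  qed (use l in auto)
  then have mem: "?m (V + a) = mem ?s a" for a by metis
  have sim: "\<exists>y. simulating ?s y r' ?m" if "common r' m" for r'
  proof -
    have "r' (x + 32) = 0" for x using that by (simp add: common_def)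
    then show ?thesis
      using that mem by (intro exI[of _ "(r', ?m)"]) (simp add: simulating_def simulates_def initial_def)
  qed
  have "wp b (header_code l) (\<lambda>r' m'. common r' m \<and> m' = ?m) r m"
    unfolding header_code_def using * cm b_V by simp (simp add: ac_simps)
  then show "wp b (header_code l) (\<lambda>r m. \<exists>y. simulating ?s y r m) r m"
    by (rule wp_mono) (use sim in auto)
qed

lemma initial_pc: "pc (initial xs) = 0"
  by (simp add: initial_def)

lemma relocated:
  assumes "V + b' \<le> b" "run P b' t s s'" "halted P s'" "pc s = 0"
  shows "triple b (\<lambda>r m. \<exists>y. simulating s y r m) (relocate 32 P) (2 * t)
    (\<lambda>r m. \<exists>y. simulating s' y r m)"
proof (rule triple_ex)
  fix y
  show "triple b (simulating s y) (relocate 32 P) (2 * t) (simulating s' y)"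
  proof (cases "common (fst y) (snd y)")
    case True
    then have "fst y 1 = V" by (simp add: common_def)
    then have "triple b (simulates 32 V (fst y) (snd y) s) (relocate 32 P) (2 * t)
        (simulates 32 V (fst y) (snd y) s')"
      by (intro triple_relocate[OF _ _ assms]) auto
    then show ?thesis
      by (rule triple_mono) (use True in \<open>auto simp: simulating_def\<close>)
  next
    case False
    then show ?thesis by (simp add: triple_def simulating_def)
  qed
qed

definition I5 :: "config \<Rightarrow> nat \<Rightarrow> (nat \<Rightarrow> nat) \<Rightarrow> (nat \<Rightarrow> nat) \<Rightarrow> bool" where
  "I5 s j r m \<longleftrightarrow> r 5 = 1 \<and> r 8 = 3 \<and> r 16 = V + reg s 0 \<and> (\<forall>t<2 * M. m (3 + t) = wd t) \<and>
     m (V + reg s 0) = mem s (reg s 0) \<and>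
     (\<forall>x<2 * mem s (reg s 0). m (V + reg s 0 + 1 + x) =
        (if x < j then mem s (reg s 0 + 1 + x) else wd (mem s (reg s 0 + 1 + x))))"

lemma output_start:
  assumes "V + 3 * b' \<le> b" "fits b' s"
  shows "triple b (\<lambda>r m. \<exists>y. simulating s y r m)
    (straight [Bin Add 16 32 1, Load 6 16, Bin Mul 6 6 7])
    (length [Bin Add 16 32 1, Load 6 16, Bin Mul 6 6 7])
    (\<lambda>r m. r 6 = 2 * mem s (reg s 0) \<and> I5 s (2 * mem s (reg s 0)) r m)"
proof (rule triple_straight, clarify)
  fix r m r0 m0 assume sim: "simulating s (r0, m0) r m"
  have r: "r 5 = 1" "r 8 = 3" "r 7 = 2" "r 1 = V"
    using sim by (auto simp: simulating_def simulates_def common_def)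
  have r32: "r 32 = reg s 0"
    using sim unfolding simulating_def simulates_def by (metis add_0 fst_conv)
  have m: "m (V + a) = mem s a" for a
    using sim by (simp add: simulating_def simulates_def)
  have w: "m (3 + t) = wd t" if "t < 2 * M" for t
    using sim that by (simp add: simulating_def simulates_def common_def V_def R_def)
  have "reg s 0 < b'" "mem s (reg s 0) < b'" using assms(2) by (auto simp: fits_def)
  then show "wp b [Bin Add 16 32 1, Load 6 16, Bin Mul 6 6 7]
      (\<lambda>r m. r 6 = 2 * mem s (reg s 0) \<and> I5 s (2 * mem s (reg s 0)) r m) r m"
    using r r32 w m[of "reg s 0"] m[of "reg s 0 + 1 + x" for x] assms(1)
    by (simp add: I5_def add.commute[of "reg s 0" V] add.assoc)
qed

lemma output_loop:
  assumes b': "V + 3 * b' \<le> b" "fits b' s" and j: "j < 2 * mem s (reg s 0)"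
    and h: "mem s (reg s 0 + 1 + j) < 2 * M"
  shows "triple b (\<lambda>r m. r 6 = Suc j \<and> I5 s (Suc j) r m) (straight output_code) (length output_code)
    (\<lambda>r m. r 6 = j \<and> I5 s j r m)"
proof (rule triple_straight, clarify)
  fix r m assume r6: "r 6 = Suc j" and I: "I5 s (Suc j) r m"
  let ?h = "mem s (reg s 0 + 1 + j)"
  let ?m = "m(V + reg s 0 + 1 + j := wd ?h)"
  have r: "r 5 = 1" "r 8 = 3" "r 16 = V + reg s 0" using I by (auto simp: I5_def)
  have m: "m (V + reg s 0 + 1 + j) = ?h" "m (3 + ?h) = wd ?h"
    using I j h by (auto simp: I5_def)
  have bd: "reg s 0 < b'" "mem s (reg s 0) < b'" using b'(2) by (auto simp: fits_def)
  have I': "I5 s j r' ?m" if "r' 5 = 1" "r' 8 = 3" "r' 16 = V + reg s 0" for r'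
    using that I by (auto simp: I5_def V_def R_def)
  \<comment> \<open>The factor 3 is used here: the output block starts below \<open>b'\<close> and
    lists fewer than \<open>2 * b'\<close> words, so its last address may exceed
    \<open>V + b'\<close>.\<close>
  have bb: "j < b" "V + reg s 0 + 1 + j < b" "?h + 3 < b" using bd b' j h b_V by linarith+
  have "wp b output_code (\<lambda>r' m'. r' 6 = j \<and> r' 5 = 1 \<and> r' 8 = 3 \<and> r' 16 = V + reg s 0 \<and> m' = ?m) r m"
    unfolding output_code_def using r r6 m bb by (simp add: ac_simps)
  then show "wp b output_code (\<lambda>r m. r 6 = j \<and> I5 s j r m) r m"
    by (rule wp_mono) (use I' in auto)
qed

definition output_spec :: "config \<Rightarrow> (nat \<Rightarrow> nat) \<Rightarrow> (nat \<Rightarrow> nat) \<Rightarrow> bool" where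
  "output_spec s r m \<longleftrightarrow> m (r 0) = mem s (reg s 0) \<and>
     (\<forall>x<2 * mem s (reg s 0). m (r 0 + 1 + x) = wd (mem s (reg s 0 + 1 + x)))"

lemma output_end:
  assumes "V + 3 * b' \<le> b" "fits b' s"
  shows "triple b (I5 s 0) (straight [Const 0 0, Bin Add 0 0 16]) (length [Const 0 0, Bin Add 0 0 16])
    (output_spec s)"
proof (rule triple_straight)
  fix r m assume I: "I5 s 0 r m"
  have "reg s 0 < b'" using assms(2) by (auto simp: fits_def)
  then show "wp b [Const 0 0, Bin Add 0 0 16] (output_spec s) r m"
    using I assms(1) by (simp add: I5_def output_spec_def)
qed

text \<open>Up to constants, the four preprocessing loops take \<open>28 * M\<close>,
  \<open>19 * M\<close>, \<open>16 * M\<close> and \<open>36 * M\<close> steps, the simulation two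
  steps per step of \<open>P\<close>, and the translation 9 steps for each of the two words of an
  output pair.\<close>

lemma reduction_triple:
  assumes l: "l = num z" and b': "V + 3 * b' \<le> b"
    and run: "run P b' t (initial (eval_input num (adj z) (query z))) s" and halt: "halted P s"
    and h: "\<And>x. x < 2 * mem s (reg s 0) \<Longrightarrow> mem s (reg s 0 + 1 + x) < 2 * M"
  shows "triple b (\<lambda>r m. r = (\<lambda>_. 0) \<and> m = mem (initial (sbmm_input n as bs))) (reduction_code l P)
    (100 * M + 100 + 2 * t + 20 * mem s (reg s 0)) (output_spec s)"
proof -
  have f: "fits b' s" using run_fits[OF run] .
  have "V + b' \<le> b" using b' by simp
  note rel = relocated[OF this run halt, OF initial_pc]
  note T = triple_seq[OF setup_triple triple_seq[OF triple_loop[OF rep_loop]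
    triple_seq[OF count_start triple_seq[OF triple_loop[OF count_loop]
    triple_seq[OF offset_start triple_seq[OF triple_loop[OF offset_loop]
    triple_seq[OF arc_start triple_seq[OF triple_loop[OF arc_loop]
    triple_seq[OF header[where num = num and z = z, OF l] triple_seq[OF rel triple_seq[OF output_start[OF b' f]
    triple_seq[OF triple_loop[OF output_loop[OF b' f _ h]] output_end[OF b' f]]]]]]]]]]]]]
  show ?thesis
    unfolding reduction_code_def
    by (rule triple_mono[OF T])
      (simp_all add: setup_code_def rep_code_def count_code_def offset_code_def arc_code_def
        header_code_def output_code_def key_addr_def)
qed

lemma output_spec_pairs:
  assumes "output_spec s (reg s') (mem s')"
  shows "output_pairs s' = map index_pair (output_pairs s)"
proof -
  have "mem s' (reg s' 0 + 1 + 2 * t) = wd (mem s (reg s 0 + 1 + 2 * t)) \<and>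
      mem s' (reg s' 0 + 2 + 2 * t) = wd (mem s (reg s 0 + 2 + 2 * t))" if "t < mem s (reg s 0)" for t
    using assms that spec[of "\<lambda>x. x < 2 * mem s (reg s 0) \<longrightarrow> _ x" "Suc (2 * t)"]
    by (auto simp: output_spec_def dest: spec[of _ "Suc (2 * t)"])
  then show ?thesis
    using assms by (simp add: output_pairs_def Let_def output_spec_def)
qed

end

section \<open>Word sizes and the overall time bound\<close>

text \<open>\<open>x\<close> and \<open>z\<close> are the bases of the word limits for the matrix
  input and the Eval input. The factor \<open>K\<close> is absorbed via \<open>K < x ^ K\<close>, so
  the exponent depends on \<open>K\<close> and \<open>c\<close> only. The bound
  \<open>5 <= x\<close> lets \<open>x * x\<close> absorb both \<open>3 * x + 3\<close> and the
  factor 25.\<close>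

lemma word_limit_bounds:
  fixes x K :: nat
  assumes x: "5 \<le> x" and V: "V \<le> 3 * x" and y: "y \<le> x + K" and z: "z \<le> K * x"
  shows "V + 3 * z ^ c \<le> x ^ (Suc K * c + K + 3)" "10 * y < x ^ (Suc K * c + K + 3)"
proof -
  let ?e = "Suc K * c"
  have K: "K < x ^ K" using x by (intro less_le_trans[OF less_exp[of K]] power_mono) auto
  have "z \<le> x ^ Suc K" using z K by (metis le_trans less_imp_le mult.commute mult_le_mono1 power_Suc)
  then have "z ^ c \<le> x ^ ?e" by (metis power_mult power_mono zero_le)
  moreover have pos: "1 \<le> x ^ k" for k using x by simp
  have "V \<le> 3 * x * x ^ ?e" using V pos[of ?e] by (metis le_trans mult_le_mono2 nat_mult_1_right)
  ultimately have "V + 3 * z ^ c \<le> (3 * x + 3) * x ^ ?e" by (simp add: algebra_simps)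
  also have "3 * x + 3 \<le> x * x" using x by (intro order_trans[OF _ mult_le_mono1[OF x]]) auto
  also have "x * x * x ^ ?e = x ^ (?e + 2)" by (simp add: power_add power2_eq_square)
  also have "\<dots> \<le> x ^ (?e + K + 3)" using x by (intro power_increasing) auto
  finally show "V + 3 * z ^ c \<le> x ^ (?e + K + 3)" by simp
  have "x + K \<le> 2 * (x * x ^ K)"
  proof -
    have "x \<le> x * x ^ K" using mult_le_mono2[OF pos[of K], of x] by simp
    moreover have "x ^ K \<le> x * x ^ K" using x by simp
    ultimately show ?thesis using K by linarith
  qed
  then have "10 * y < 25 * (x * x ^ K)" using y x pos[of K] by simp
  also have "25 * (x * x ^ K) \<le> (x * x) * (x * x ^ K)"
    using mult_le_mono[OF x x] by (intro mult_le_mono1) simp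
  also have "\<dots> = x ^ (K + 3)" by (simp add: power_add eval_nat_numeral)
  also have "\<dots> \<le> x ^ (?e + K + 3)" using x by (intro power_increasing) auto
  finally show "10 * y < x ^ (?e + K + 3)" .
qed

lemma (in sbmm_lists) reduction_correct:
  fixes num :: "'a \<Rightarrow> nat" and z :: 'a
  assumes comp: "computes_within P c (eval_input num (adj z) (query z)) T (rpq_result (query z) (db z))"
    and as: "set as = one_entries n A" and bs: "set bs = one_entries n B"
  shows "computes_within (reduction_code (num z) P 0)
    (Suc (num z + 13) * c + (num z + 13) + 3) (sbmm_input n as bs)
    (100 * M + 100 + 2 * T + 20 * card (one_entries n (bool_matrix_mult n A B)))
    (one_entries n (bool_matrix_mult n A B))"
proof -
  let ?Y = "sbmm_input n as bs" let ?X = "eval_input num (adj z) (query z)"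
  \<comment> \<open>The base of the Eval word limit is at most
    \<open>(4 * M + 7) + (2 * M + num z + 4) + 2\<close>, that is,
    \<open>6 * M + num z + 13\<close>.\<close>
  let ?K = "num z + 13" let ?c = "Suc (num z + 13) * c + (num z + 13) + 3"
  let ?P = "reduction_code (num z) P 0"
  let ?Q = "one_entries n (bool_matrix_mult n A B)"
  define x where "x = length ?Y + Max (insert 0 (set ?Y)) + 2"
  define b where "b = word_limit ?c ?Y"
  define b' where "b' = word_limit c ?X"
  have b_eq: "b = x ^ ?c" by (simp add: b_def word_limit_def x_def)
  have "n \<le> Max (insert 0 (set ?Y))" by (rule Max_ge) (auto simp: sbmm_input_def)
  then have x: "5 + 2 * M + n \<le> x" by (simp add: x_def sbmm_input_def M_def)
  have "Max (insert 0 (set ?X)) \<le> 2 * M + num z + 4"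
    by (subst Max_le_iff) (auto dest: eval_input_bound)
  then have "length ?X + Max (insert 0 (set ?X)) + 2 \<le> 6 * M + num z + 13"
    unfolding length_eval_input by linarith
  also have "\<dots> \<le> ?K * x"
  proof -
    have "num z * 1 \<le> num z * x" using x by (intro mult_le_mono2) linarith
    then show ?thesis using x unfolding add_mult_distrib by linarith
  qed
  finally have z: "length ?X + Max (insert 0 (set ?X)) + 2 \<le> ?K * x" .
  have "3 + 2 * M + 3 * n \<le> 3 * x" "n + length as + length bs + num z + 10 \<le> x + ?K" "5 \<le> x"
    using x by (auto simp: M_def)
  note bounds = word_limit_bounds[OF this(3,1,2) z, of c, folded b_eq]
  interpret sbmm_run n as bs "num z" b
    by unfold_locales (rule bounds(2))
  have Vb: "V + 3 * b' \<le> b"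
    using bounds(1) by (simp add: b'_def word_limit_def V_def R_def)
  obtain t s where t: "t \<le> T" "run P b' t (initial ?X) s" "halted P s"
    "distinct (output_pairs s)" "set (output_pairs s) = rpq_result (query z) (db z)"
    using comp unfolding computes_within_def run_def b'_def by blast
  let ?p = "reg s 0" let ?l = "mem s ?p"
  have pair: "mem s (?p + 1 + 2 * u) < 2 * M \<and> mem s (?p + 2 + 2 * u) < 2 * M"
    if "u < ?l" for u
  proof -
    have "(mem s (?p + 1 + 2 * u), mem s (?p + 2 + 2 * u)) \<in> set (output_pairs s)"
      using that by (auto simp: output_pairs_def Let_def)
    then show ?thesis unfolding t(5) by (rule result_less)
  qed
  have h: "mem s (?p + 1 + v) < 2 * M" if "v < 2 * ?l" for v
  proof -
    have v: "v div 2 < ?l" using that by auto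
    have "?p + 1 + v = ?p + 1 + 2 * (v div 2) \<or> ?p + 1 + v = ?p + 2 + 2 * (v div 2)"
      by presburger
    then show ?thesis using pair[OF v] by metis
  qed
  have "5 \<le> b" using bounds(2) b_V by simp
  have "fits b (initial ?Y)"
  proof -
    have "v < b" if "v \<in> set ?Y" for v
    proof -
      have "v \<le> Max (insert 0 (set ?Y))" using that by (intro Max_ge) auto
      then have "v < x" by (simp add: x_def)
      also have "x \<le> b" unfolding b_eq by (rule self_le_power) (use x in auto)
      finally show ?thesis .
    qed
    then show ?thesis using \<open>5 \<le> b\<close> by (simp add: fits_def initial_def)
  qed
  \<comment> \<open>With empty code on both sides the fragment is the whole program, so reaching its
    end means halting.\<close>
  then obtain u s' where u: "u \<le> 100 * M + 100 + 2 * t + 20 * ?l"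
    "run ?P b u (initial ?Y) s'" "pc s' = length ?P"
    "output_spec s (reg s') (mem s')"
    using reduction_triple[OF refl Vb t(2,3) h, unfolded triple_def, rule_format,
        of "initial ?Y" "[]" "[]"]
    by (auto simp: initial_def)
  have out: "output_pairs s' = map index_pair (output_pairs s)"
    using output_spec_pairs[OF u(4)] .
  have "?l = length (output_pairs s)" by (simp add: output_pairs_def Let_def)
  also have "\<dots> = card (rpq_result (query z) (db z))"
    using t(4,5) distinct_card by metis
  also have "\<dots> = card ?Q"
    using card_image[OF inj_result[of z]] image_result[OF as bs, of z] by simp
  finally have l: "?l = card ?Q" .
  have "distinct (output_pairs s')" "set (output_pairs s') = ?Q"
    using t(4,5) inj_result[of z] image_result[OF as bs, of z] by (simp_all add: out distinct_map)
  moreover have "u \<le> 100 * M + 100 + 2 * T + 20 * card ?Q"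
    using u(1) t(1) l by simp
  ultimately show ?thesis
    using u(2,3) unfolding computes_within_def run_def b_def halted_def
    by (intro exI[of _ u]) auto
qed

theorem theorem5p12:
  fixes num :: "'a::finite \<Rightarrow> nat"
  assumes "inj num"
    and "\<exists>f. eval_solvable num f"
  shows "\<not> sbmm_hypothesis"
proof -
  obtain f P c C where eval: "\<forall>(D :: (nat, 'a) graph_db) vs adj q.
      graph_database D \<longrightarrow> adjacency_lists D vs adj \<longrightarrow>
      computes_within P c (eval_input num adj q)
        (C * ((card (rpq_result q D) + db_size D + 1) * f (rpq_length q)))
        {(i, j). i < length vs \<and> j < length vs \<and> (vs ! i, vs ! j) \<in> rpq_result q D}"
    using assms(2) unfolding eval_solvable_def by blast
  \<comment> \<open>Any letter will do; one exists because types are nonempty.\<close>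
  define z :: 'a where "z = undefined"
  let ?c = "Suc (num z + 13) * c + (num z + 13) + 3"
  \<comment> \<open>One factor 2 stems from the simulation, the other from the database size
    \<open>2 * M\<close>; the query has length 3.\<close>
  let ?C = "100 + 4 * (C * f 3)"
  have "computes_within (reduction_code (num z) P 0) ?c (sbmm_input n as bs)
      (?C * (card (one_entries n A) + card (one_entries n B) +
        card (one_entries n (bool_matrix_mult n A B)) + 1))
      (one_entries n (bool_matrix_mult n A B))"
    if das: "distinct as" and as: "set as = one_entries n A"
      and dbs: "distinct bs" and bs: "set bs = one_entries n B" for n A B as bs
  proof -
    interpret sbmm_lists n as bs
      by unfold_locales (use that in \<open>auto simp: one_entries_def\<close>)
    let ?T = "C * ((card (rpq_result (query z) (db z)) + db_size (db z) + 1) * f 3)"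
    let ?Q = "one_entries n (bool_matrix_mult n A B)"
    have "{(i, j). i < 2 * M \<and> j < 2 * M \<and> ([0..<2 * M] ! i, [0..<2 * M] ! j) \<in> rpq_result (query z) (db z)}
        = rpq_result (query z) (db z)"
      by (auto dest: result_less) (frule result_less, simp)
    then have "computes_within P c (eval_input num (adj z) (query z)) ?T (rpq_result (query z) (db z))"
      using eval[rule_format, OF graph_database_db adjacency_lists_db, of z "query z"]
      by (simp add: query_def numeral_3_eq_3)
    note red = reduction_correct[OF this as bs]
    have M: "M = card (one_entries n A) + card (one_entries n B)"
      using distinct_card[OF das] distinct_card[OF dbs] as bs by (simp add: M_def)
    have card: "card (rpq_result (query z) (db z)) = card ?Q"
      using card_image[OF inj_result[of z]] image_result[OF as bs, of z] by simp
    have "?T \<le> C * ((2 * (M + card ?Q + 1)) * f 3)"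
      unfolding card using db_size_db[of z] by (intro mult_le_mono2 mult_le_mono1) simp
    then have "2 * ?T \<le> 4 * (C * f 3) * (M + card ?Q + 1)"
      by (simp add: algebra_simps)
    moreover have "100 * M + 100 + 20 * card ?Q \<le> 100 * (M + card ?Q + 1)"
      by simp
    ultimately have "100 * M + 100 + 2 * ?T + 20 * card ?Q \<le>
        100 * (M + card ?Q + 1) + 4 * (C * f 3) * (M + card ?Q + 1)"
      by linarith
    also have "\<dots> = ?C * (M + card ?Q + 1)"
      by (rule add_mult_distrib[symmetric])
    finally have "100 * M + 100 + 2 * ?T + 20 * card ?Q \<le> ?C * (M + card ?Q + 1)" .
    then show ?thesis
      using red unfolding computes_within_def M by (meson le_trans)
  qed
  then have sbmm_linear_time
    unfolding sbmm_linear_time_def by blast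
  then show ?thesis by (simp add: sbmm_hypothesis_def)
qed

end
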